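(* Let $n\ge 2$ be an integer, $T=\{1,\ldots,\lfloor n/2\rfloor\}$, $S\subsetneq T$, $\bar S=T\setminus S$, and let $G=C_n(S)$ be the circulant graph on $S$. Let $K$ be a field, $R=K[x_0,\ldots,x_{n-1}]$, $I(G)$ the edge ideal of $G$, and $\Delta(G)$ the independence complex of $G$. The following are equivalent: (1) $R/I(G)$ is Cohen–Macaulay of Krull dimension $2$; (2) $\Delta(G)$ is connected and has dimension $1$; (3) $\gcd(n,\bar S)=1$ (the greatest common divisor of $n$ and all elements of $\bar S$), and for all $a,b\in\bar S$ we have $b-a\notin\bar S$ and $n-(b+a)\notin\bar S$.
   Context: For $k\in\mathbb{Z}$ write $|k|_n=\min\{|k|,\,n-|k|\}$. The circulant graph $C_n(S)$ has vertex set $\mathbb{Z}_n=\{0,1,\ldots,n-1\}$ and edge set $\{\{i,j\} : |j-i|_n\in S\}$. The edge ideal $I(G)\subseteq R$ is generated by the monomials $x_ix_j$ with $\{i,j\}$ an edge of $G$. The independence complex $\Delta(G)$ is the simplicial complex on $V(G)$ whose faces are the independent sets of $G$; a face $F$ has dimension $|F|-1$. A simplicial complex is connected if the graph formed by its vertices and $1$-dimensional faces is connected. *)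

theory Defs
  imports Main "HOL-Library.Poly_Mapping"
begin

definition circ_dist :: "nat \<Rightarrow> nat \<Rightarrow> nat \<Rightarrow> nat" where
  "circ_dist n i j = min (if i \<le> j then j - i else i - j) (n - (if i \<le> j then j - i else i - j))"

definition circulant_adj :: "nat \<Rightarrow> nat set \<Rightarrow> nat \<Rightarrow> nat \<Rightarrow> bool" where
  "circulant_adj n S i j \<longleftrightarrow> i < n \<and> j < n \<and> i \<noteq> j \<and> circ_dist n i j \<in> S"

definition independent_set :: "nat set \<Rightarrow> (nat \<Rightarrow> nat \<Rightarrow> bool) \<Rightarrow> nat set \<Rightarrow> bool" where
  "independent_set V E F \<longleftrightarrow> F \<subseteq> V \<and> (\<forall>u\<in>F. \<forall>v\<in>F. \<not> E u v)"

definition indep_complex_dim :: "nat set \<Rightarrow> (nat \<Rightarrow> nat \<Rightarrow> bool) \<Rightarrow> int" where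
  "indep_complex_dim V E = int (Max (card ` {F. independent_set V E F})) - 1"

definition indep_complex_connected :: "nat set \<Rightarrow> (nat \<Rightarrow> nat \<Rightarrow> bool) \<Rightarrow> bool" where
  "indep_complex_connected V E \<longleftrightarrow>
     (\<forall>u\<in>V. \<forall>v\<in>V. (\<lambda>x y. independent_set V E {x, y} \<and> card {x, y} = 2)\<^sup>*\<^sup>* u v)"

text \<open>Polynomials are finitely supported maps from monomials (nat =>0 nat) to coefficients;
  R_n is the subring of polynomials involving only the variables x_0,...,x_{n-1}.\<close>
type_synonym 'k mpoly = "(nat \<Rightarrow>\<^sub>0 nat) \<Rightarrow>\<^sub>0 'k"

definition poly_ring :: "nat \<Rightarrow> 'k::field mpoly set" where
  "poly_ring n = {p. \<forall>m\<in>Poly_Mapping.keys p. Poly_Mapping.keys m \<subseteq> {..<n}}"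

definition var :: "nat \<Rightarrow> 'k::field mpoly" where
  "var i = Poly_Mapping.single (Poly_Mapping.single i 1) 1"

definition is_ideal :: "nat \<Rightarrow> 'k::field mpoly set \<Rightarrow> bool" where
  "is_ideal n J \<longleftrightarrow> J \<subseteq> poly_ring n \<and> 0 \<in> J \<and> (\<forall>a\<in>J. \<forall>b\<in>J. a + b \<in> J)
     \<and> (\<forall>p\<in>poly_ring n. \<forall>a\<in>J. p * a \<in> J)"

definition ideal_gen :: "nat \<Rightarrow> 'k::field mpoly set \<Rightarrow> 'k mpoly set" where
  "ideal_gen n A = \<Inter>{J. is_ideal n J \<and> A \<subseteq> J}"

definition prime_ideal :: "nat \<Rightarrow> 'k::field mpoly set \<Rightarrow> bool" where
  "prime_ideal n Q \<longleftrightarrow> is_ideal n Q \<and> Q \<noteq> poly_ring n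
     \<and> (\<forall>a\<in>poly_ring n. \<forall>b\<in>poly_ring n. a * b \<in> Q \<longrightarrow> a \<in> Q \<or> b \<in> Q)"

definition prime_chain :: "nat \<Rightarrow> 'k::field mpoly set \<Rightarrow> nat \<Rightarrow> bool" where
  "prime_chain n I k \<longleftrightarrow> (\<exists>Q :: nat \<Rightarrow> 'k mpoly set.
      (\<forall>i\<le>k. prime_ideal n (Q i) \<and> I \<subseteq> Q i) \<and> (\<forall>i<k. Q i \<subset> Q (Suc i)))"

definition krull_dim_quot :: "nat \<Rightarrow> 'k::field mpoly set \<Rightarrow> nat" where
  "krull_dim_quot n I = Sup {k. prime_chain n I k}"

definition max_ideal :: "nat \<Rightarrow> 'k::field mpoly set" where
  "max_ideal n = ideal_gen n (var ` {..<n})"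

definition regular_seq :: "nat \<Rightarrow> 'k::field mpoly set \<Rightarrow> 'k mpoly list \<Rightarrow> bool" where
  "regular_seq n I fs \<longleftrightarrow> set fs \<subseteq> max_ideal n
     \<and> ideal_gen n (I \<union> set fs) \<noteq> poly_ring n
     \<and> (\<forall>k<length fs. \<forall>g\<in>poly_ring n.
          fs ! k * g \<in> ideal_gen n (I \<union> set (take k fs)) \<longrightarrow> g \<in> ideal_gen n (I \<union> set (take k fs)))"

definition depth_quot :: "nat \<Rightarrow> 'k::field mpoly set \<Rightarrow> nat" where
  "depth_quot n I = Sup {length fs | fs. regular_seq n I fs}"

text \<open>R/I (I homogeneous) is Cohen--Macaulay iff depth_m(R/I) = dim(R/I).\<close>
definition cohen_macaulay :: "nat \<Rightarrow> 'k::field mpoly set \<Rightarrow> bool" where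
  "cohen_macaulay n I \<longleftrightarrow> depth_quot n I = krull_dim_quot n I"

definition edge_ideal :: "nat \<Rightarrow> (nat \<Rightarrow> nat \<Rightarrow> bool) \<Rightarrow> 'k::field mpoly set" where
  "edge_ideal n E = ideal_gen n {var i * var j | i j. i < n \<and> j < n \<and> E i j}"

end

theory Submission
  imports Defs "HOL-Library.FuncSet"
begin

text \<open>The Krull dimension of \<open>R/I(G)\<close> is one more than the dimension of the independence complex:
  the primes generated by variables give long enough chains, and a longer chain would
  contradict the algebraic dependence of more than \<open>d\<close> polynomials in \<open>d\<close> variables. A regular
  sequence produces a chain of primes of the same length, hence the depth is at most the
  dimension. For a complex of dimension one it remains to decide when there is a regular sequence
  of length two. On a connected complex the first two elementary symmetric polynomials,
  read modulo \<open>I(G)\<close>, form one: restricted to an edge they are \<open>x + y\<close> and \<open>x * y\<close>, and the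
  quotients found on the edges agree at the vertices. On a disconnected complex
  the depth is at most one. The faces of the complex of \<open>C\<^sub>n(S)\<close> are the sets of residues with differences
  in the complement of \<open>S\<close>: connectedness means that these differences generate the integers modulo \<open>n\<close>,
  and the absence of 2-dimensional faces means that no three of them sum to zero.\<close>

text \<open>The edge ideal and the primes generated by variables are monomial, so membership in them
  is decided coefficient by coefficient: only monomials supported on a face survive modulo
  \<open>I(G)\<close>. Connectedness governs the depth through constant terms. If no face joins the
  vertex sets \<open>A\<close> and \<open>B\<close>, then the part of \<open>f1\<close> involving
  \<open>A\<close> is, modulo \<open>I(G)\<close>, \<open>f1\<close> times a function equal to 1 on
  \<open>A\<close> and to 0 on \<open>B\<close>. No polynomial is such a function, as its constant
  term would have to be both 1 and 0. On a connected complex the quotients on single edges have the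
  same constant term, which is passed along paths, and any other surviving monomial belongs to one
  vertex or to one edge. The field may be finite, so two linear forms that are independent on every
  edge need not exist. The symmetric polynomials serve over every field, at the price of one element
  of degree two.\<close>

abbreviation (input) keys where "keys \<equiv> Poly_Mapping.keys"
abbreviation (input) lookup where "lookup \<equiv> Poly_Mapping.lookup"
abbreviation (input) single where "single \<equiv> Poly_Mapping.single"

subsection \<open>Polynomials and ideals\<close>

lemma keys_add_nat: "keys (a + b) = keys a \<union> keys (b :: 'a \<Rightarrow>\<^sub>0 nat)"
  by (auto simp: in_keys_iff lookup_add)

text \<open>Cancellation in the exponent monoid leaves a single term of the convolution.\<close>

lemma lookup_mult_single_add:
  fixes p :: "'a::cancel_comm_monoid_add \<Rightarrow>\<^sub>0 'b::semiring_0"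
  shows "lookup (single a c * p) (a + m) = c * lookup p m"
proof -
  have "(\<Sum>l. lookup (single a c) l * (\<Sum>q. lookup p q when a + m = l + q))
      = (\<Sum>l. (c * (\<Sum>q. lookup p q when a + m = l + q)) when l = a)"
    by (intro Sum_any.cong) (auto simp: lookup_single when_def)
  also have "\<dots> = c * (\<Sum>q. lookup p q when a + m = a + q)"
    by simp
  also have "(\<Sum>q. lookup p q when a + m = a + q) = (\<Sum>q. lookup p q when q = m)"
    by (intro Sum_any.cong) (auto simp: when_def)
  finally show ?thesis by (simp add: lookup_mult)
qed

lemma lookup_mult_const: "lookup (single 0 c * p) m = c * lookup p m"
  for p :: "'a::cancel_comm_monoid_add \<Rightarrow>\<^sub>0 'b::semiring_0"
  using lookup_mult_single_add[of 0 c p m] by simp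

lemma sum_monomials: "(\<Sum>m\<in>keys p. single m (lookup p m)) = (p :: 'a \<Rightarrow>\<^sub>0 'b::comm_monoid_add)"
  by (rule poly_mapping_eqI)
    (auto simp: lookup_sum lookup_single when_def in_keys_iff if_distrib sum.delta)

text \<open>Serves to split off the part of a polynomial that lies in a given monomial
  ideal.\<close>

definition restrict_keys :: "('a \<Rightarrow>\<^sub>0 'b::comm_monoid_add) \<Rightarrow> 'a set \<Rightarrow> ('a \<Rightarrow>\<^sub>0 'b)" where
  "restrict_keys p M = (\<Sum>m\<in>keys p \<inter> M. single m (lookup p m))"

lemma lookup_restrict_keys: "lookup (restrict_keys p M) m = (if m \<in> M then lookup p m else 0)"
  by (auto simp: restrict_keys_def lookup_sum lookup_single when_def in_keys_iff if_distrib sum.delta)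

lemma keys_restrict_keys: "keys (restrict_keys p M) = keys p \<inter> M"
  by (auto simp: in_keys_iff lookup_restrict_keys split: if_splits)

lemma restrict_keys_split:
  "p = restrict_keys p M + restrict_keys (p :: 'a \<Rightarrow>\<^sub>0 'b::comm_monoid_add) (- M)"
  by (rule poly_mapping_eqI) (auto simp: lookup_add lookup_restrict_keys)

lemma poly_ring_add: "p \<in> poly_ring n \<Longrightarrow> q \<in> poly_ring n \<Longrightarrow> p + q \<in> poly_ring n"
  unfolding poly_ring_def using keys_add[of p q] by fastforce

lemma poly_ring_mult: "p \<in> poly_ring n \<Longrightarrow> q \<in> poly_ring n \<Longrightarrow> p * q \<in> poly_ring n"
  unfolding poly_ring_def using keys_mult[of p q] by (fastforce simp: keys_add_nat)

lemma poly_ring_zero: "0 \<in> poly_ring n"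
  by (simp add: poly_ring_def)

lemma poly_ring_one: "1 \<in> poly_ring n"
  by (simp add: poly_ring_def)

lemma poly_ring_single: "keys m \<subseteq> {..<n} \<Longrightarrow> single m c \<in> poly_ring n"
  by (simp add: poly_ring_def)

lemma poly_ring_var: "i < n \<Longrightarrow> var i \<in> poly_ring n"
  by (simp add: poly_ring_def var_def)

lemma poly_ring_uminus: "p \<in> poly_ring n \<Longrightarrow> - p \<in> poly_ring n"
  by (simp add: poly_ring_def in_keys_iff)

lemma poly_ring_diff: "p \<in> poly_ring n \<Longrightarrow> q \<in> poly_ring n \<Longrightarrow> p - q \<in> poly_ring n"
  using poly_ring_add[of p n "- q"] poly_ring_uminus[of q n] by simp

lemma poly_ring_sum: "(\<And>x. x \<in> A \<Longrightarrow> f x \<in> poly_ring n) \<Longrightarrow> sum f A \<in> poly_ring n"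
  by (induction A rule: infinite_finite_induct) (auto simp: poly_ring_zero poly_ring_add)

lemma poly_ring_power: "p \<in> poly_ring n \<Longrightarrow> p ^ k \<in> poly_ring n"
  by (induction k) (auto simp: poly_ring_one poly_ring_mult)

lemma poly_ring_prod: "(\<And>x. x \<in> A \<Longrightarrow> f x \<in> poly_ring n) \<Longrightarrow> prod f A \<in> poly_ring n"
  by (induction A rule: infinite_finite_induct) (auto simp: poly_ring_one poly_ring_mult)

lemma poly_ring_restrict_keys: "p \<in> poly_ring n \<Longrightarrow> restrict_keys p M \<in> poly_ring n"
  by (auto simp: poly_ring_def keys_restrict_keys)

lemmas poly_ring_intros = poly_ring_add poly_ring_mult poly_ring_zero poly_ring_one poly_ring_var
  poly_ring_diff poly_ring_sum poly_ring_power poly_ring_prod poly_ring_restrict_keys poly_ring_uminus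

section \<open>Ideals of the polynomial ring\<close>

lemma is_idealD:
  assumes "is_ideal n J"
  shows "a \<in> J \<Longrightarrow> a \<in> poly_ring n" "0 \<in> J" "a \<in> J \<Longrightarrow> b \<in> J \<Longrightarrow> a + b \<in> J"
    "p \<in> poly_ring n \<Longrightarrow> a \<in> J \<Longrightarrow> p * a \<in> J" "p \<in> poly_ring n \<Longrightarrow> a \<in> J \<Longrightarrow> a * p \<in> J"
  using assms by (auto simp: is_ideal_def mult.commute)

lemma is_ideal_uminus:
  assumes "is_ideal n J" "a \<in> J" shows "- a \<in> J"
  using is_idealD(4)[OF assms(1) _ assms(2), of "- 1"] by (simp add: poly_ring_intros)

lemma is_ideal_diff:
  assumes "is_ideal n J" "a \<in> J" "b \<in> J" shows "a - b \<in> J"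
  using is_idealD(3)[OF assms(1,2), of "- b"] is_ideal_uminus[OF assms(1,3)] by simp

lemma is_ideal_sum:
  assumes "is_ideal n J" "\<And>x. x \<in> A \<Longrightarrow> f x \<in> J" shows "sum f A \<in> J"
  using assms(2) by (induction A rule: infinite_finite_induct) (auto intro: is_idealD[OF assms(1)])

lemma is_ideal_eq_poly_ring_iff:
  assumes "is_ideal n J" shows "J = poly_ring n \<longleftrightarrow> 1 \<in> J"
proof
  assume "1 \<in> J"
  then have "p \<in> J" if "p \<in> poly_ring n" for p
    using is_idealD(4)[OF assms that, of 1] by simp
  then show "J = poly_ring n" using is_idealD(1)[OF assms] by blast
qed (simp add: poly_ring_one)

lemma poly_ring_is_ideal: "is_ideal n (poly_ring n)"
  by (simp add: is_ideal_def poly_ring_intros)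

text \<open>The hypothesis puts the whole ring among the ideals intersected; otherwise the
  intersection would run over the empty family.\<close>

lemma is_ideal_ideal_gen: "A \<subseteq> poly_ring n \<Longrightarrow> is_ideal n (ideal_gen n A)"
  unfolding ideal_gen_def using poly_ring_is_ideal[of n]
  by (subst is_ideal_def) (auto simp: is_ideal_def)

lemma ideal_gen_superset: "A \<subseteq> ideal_gen n A"
  by (auto simp: ideal_gen_def)

lemma ideal_gen_subset: "is_ideal n J \<Longrightarrow> A \<subseteq> J \<Longrightarrow> ideal_gen n A \<subseteq> J"
  by (auto simp: ideal_gen_def)

lemma ideal_gen_mono: "A \<subseteq> B \<Longrightarrow> ideal_gen n A \<subseteq> ideal_gen n B"
  by (auto simp: ideal_gen_def)

lemma ideal_gen_ideal: "is_ideal n J \<Longrightarrow> ideal_gen n J = J"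
  using ideal_gen_superset[of J n] ideal_gen_subset[of n J J] by blast

text \<open>This explicit form of \<open>J + (f)\<close> serves twice: to enlarge an ideal in the
  Zorn argument, and to express membership modulo the first element of a regular sequence.\<close>

lemma is_ideal_insert:
  fixes f :: "'k::field mpoly"
  assumes J: "is_ideal n J" and f: "f \<in> poly_ring n"
  shows "is_ideal n {a + f * h | a h. a \<in> J \<and> h \<in> poly_ring n}" (is "is_ideal n ?K")
  unfolding is_ideal_def
proof (intro conjI ballI)
  show "?K \<subseteq> poly_ring n"
    using f is_idealD(1)[OF J] by (auto intro!: poly_ring_intros)
  show "0 \<in> ?K"
    using is_idealD(2)[OF J] poly_ring_zero[of n] by force
next
  fix x y :: "'k mpoly" assume "x \<in> ?K" "y \<in> ?K"
  then obtain a h b k where *: "x = a + f * h" "a \<in> J" "h \<in> poly_ring n"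
    "y = b + f * k" "b \<in> J" "k \<in> poly_ring n" by blast
  then have "x + y = (a + b) + f * (h + k)" by (simp add: algebra_simps)
  moreover have "a + b \<in> J" "h + k \<in> poly_ring n"
    using * is_idealD(3)[OF J] by (auto intro: poly_ring_intros)
  ultimately show "x + y \<in> ?K" by blast
next
  fix p x :: "'k mpoly" assume "p \<in> poly_ring n" "x \<in> ?K"
  then obtain a h where *: "x = a + f * h" "a \<in> J" "h \<in> poly_ring n" by blast
  then have "p * x = p * a + f * (p * h)" by (simp add: algebra_simps)
  moreover have "p * a \<in> J" "p * h \<in> poly_ring n"
    using * \<open>p \<in> poly_ring n\<close> is_idealD(4)[OF J] by (auto intro: poly_ring_intros)
  ultimately show "p * x \<in> ?K" by blast
qed

lemma ideal_gen_insert: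
  assumes J: "is_ideal n J" and f: "f \<in> poly_ring n"
  shows "ideal_gen n (insert f J) = {a + f * h | a h. a \<in> J \<and> h \<in> poly_ring n}" (is "_ = ?K")
proof
  have "f \<in> ?K" using is_idealD(2)[OF J] poly_ring_one[of n] by force
  moreover have "J \<subseteq> ?K" using poly_ring_zero[of n] by force
  ultimately show "ideal_gen n (insert f J) \<subseteq> ?K"
    by (intro ideal_gen_subset is_ideal_insert J f) auto
  have "insert f J \<subseteq> poly_ring n" using f is_idealD(1)[OF J] by auto
  note K = is_ideal_ideal_gen[OF this]
  have sub: "insert f J \<subseteq> ideal_gen n (insert f J)" by (rule ideal_gen_superset)
  show "?K \<subseteq> ideal_gen n (insert f J)"
    using sub by (auto intro!: is_idealD(3)[OF K] is_idealD(5)[OF K])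
qed

lemma prime_idealD:
  assumes "prime_ideal n Q"
  shows "is_ideal n Q" "1 \<notin> Q"
    "a \<in> poly_ring n \<Longrightarrow> b \<in> poly_ring n \<Longrightarrow> a * b \<in> Q \<Longrightarrow> a \<in> Q \<or> b \<in> Q"
  using assms is_ideal_eq_poly_ring_iff unfolding prime_ideal_def by blast+

subsection \<open>Ideals generated by variables\<close>

text \<open>The ideal generated by the variables with index in \<open>A\<close>, given through its
  monomials. \<open>A = {}\<close> yields the zero ideal, \<open>A = {..<n}\<close> the maximal
  ideal, and the complement of a face a prime over the edge ideal.\<close>

definition vars_ideal :: "nat \<Rightarrow> nat set \<Rightarrow> 'k::field mpoly set" where
  "vars_ideal n A = {p \<in> poly_ring n. \<forall>m\<in>keys p. keys m \<inter> A \<noteq> {}}"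

lemma vars_ideal_mono: "A \<subseteq> B \<Longrightarrow> vars_ideal n A \<subseteq> vars_ideal n B"
  by (auto simp: vars_ideal_def)

lemma vars_ideal_lookup: "p \<in> vars_ideal n A \<Longrightarrow> keys m \<inter> A = {} \<Longrightarrow> lookup p m = 0"
  by (auto simp: vars_ideal_def in_keys_iff)

lemma is_ideal_vars_ideal: "is_ideal n (vars_ideal n A)"
  unfolding is_ideal_def
proof (intro conjI ballI)
  show "vars_ideal n A \<subseteq> poly_ring n" by (auto simp: vars_ideal_def)
  show "0 \<in> vars_ideal n A" by (auto simp: vars_ideal_def poly_ring_zero)
next
  fix a b :: "'a mpoly" assume "a \<in> vars_ideal n A" "b \<in> vars_ideal n A"
  then show "a + b \<in> vars_ideal n A"
    unfolding vars_ideal_def using keys_add[of a b] by (auto intro: poly_ring_intros)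
next
  fix a b :: "'a mpoly" assume "a \<in> poly_ring n" "b \<in> vars_ideal n A"
  then show "a * b \<in> vars_ideal n A"
    unfolding vars_ideal_def using keys_mult[of a b]
    by (fastforce intro: poly_ring_intros simp: keys_add_nat)
qed

lemma restrict_keys_in_vars_ideal:
  "p \<in> poly_ring n \<Longrightarrow> (\<And>m. m \<in> M \<Longrightarrow> keys m \<inter> A \<noteq> {}) \<Longrightarrow> restrict_keys p M \<in> vars_ideal n A"
  by (auto simp: vars_ideal_def poly_ring_intros keys_restrict_keys)

lemma var_in_vars_ideal: "i < n \<Longrightarrow> i \<in> A \<Longrightarrow> var i \<in> vars_ideal n A"
  by (auto simp: vars_ideal_def poly_ring_def var_def)

text \<open>Removing from both factors the monomials that meet \<open>A\<close> changes the product
  only by elements of the ideal. What remains of the product has no monomial meeting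
  \<open>A\<close> and yet lies in the ideal, so it is zero, and polynomials form a domain.\<close>

lemma prime_ideal_vars_ideal: "prime_ideal n (vars_ideal n A :: 'k::field mpoly set)"
proof -
  let ?P = "vars_ideal n A :: 'k mpoly set"
  note P = is_ideal_vars_ideal[of n A, where 'a = 'k]
  let ?M = "{m :: nat \<Rightarrow>\<^sub>0 nat. keys m \<inter> A \<noteq> {}}"
  have "a \<in> ?P \<or> b \<in> ?P" if a: "a \<in> poly_ring n" and b: "b \<in> poly_ring n" and ab: "a * b \<in> ?P"
    for a b :: "'k mpoly"
  proof -
    define a1 where "a1 = restrict_keys a ?M"
    define a0 where "a0 = restrict_keys a (- ?M)"
    define b1 where "b1 = restrict_keys b ?M"
    define b0 where "b0 = restrict_keys b (- ?M)"
    have ring: "a0 \<in> poly_ring n" "b0 \<in> poly_ring n"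
      unfolding a0_def b0_def by (intro poly_ring_intros a b)+
    have in1: "a1 \<in> ?P" "b1 \<in> ?P"
      unfolding a1_def b1_def by (intro restrict_keys_in_vars_ideal a b; simp)+
    have eq: "a = a1 + a0" "b = b1 + b0"
      unfolding a1_def a0_def b1_def b0_def by (rule restrict_keys_split)+
    have "a0 * b0 = a * b - (b * a1 + a0 * b1)"
      by (simp add: eq algebra_simps)
    also have "\<dots> \<in> ?P"
      using ab in1 ring b by (auto intro!: is_ideal_diff[OF P] is_idealD(3-4)[OF P])
    finally have "a0 * b0 \<in> ?P" .
    moreover have "keys m \<inter> A = {}" if "m \<in> keys (a0 * b0)" for m
      using subsetD[OF keys_mult that]
      by (auto simp: a0_def b0_def keys_restrict_keys keys_add_nat)
    ultimately have "keys (a0 * b0) = {}"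
      unfolding vars_ideal_def by blast
    then have "a0 = 0 \<or> b0 = 0" by simp
    then show ?thesis using eq in1 by auto
  qed
  moreover have "1 \<notin> ?P" by (simp add: vars_ideal_def)
  ultimately show ?thesis
    unfolding prime_ideal_def using P is_ideal_eq_poly_ring_iff[OF P] by blast
qed

lemma poly_in_idealI:
  assumes "is_ideal n J" and "\<And>m c. m \<in> keys p \<Longrightarrow> single m c \<in> J"
  shows "p \<in> J"
  using is_ideal_sum[OF assms(1), of "keys p" "\<lambda>m. single m (lookup p m)"] assms(2)
  by (simp add: sum_monomials)

lemma single_in_idealI:
  fixes m :: "nat \<Rightarrow>\<^sub>0 nat"
  assumes J: "is_ideal n J" and m: "keys m \<subseteq> {..<n}" and i: "i \<in> keys m" "var i \<in> J"
  shows "single m c \<in> J"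
proof -
  define m' where "m' = m - single i 1"
  have m_eq: "m = m' + single i 1"
    by (rule poly_mapping_eqI)
      (use i(1) in \<open>auto simp: m'_def lookup_add lookup_minus lookup_single when_def in_keys_iff\<close>)
  have "keys m' \<subseteq> {..<n}"
    using m m_eq keys_add_nat by (metis Un_subset_iff)
  then have "single m' c * var i \<in> J"
    by (intro is_idealD(4)[OF J] i poly_ring_single)
  then show ?thesis by (simp add: var_def mult_single m_eq)
qed

lemma max_ideal_eq: "max_ideal n = (vars_ideal n {..<n} :: 'k::field mpoly set)"
proof
  show "max_ideal n \<subseteq> (vars_ideal n {..<n} :: 'k mpoly set)"
    unfolding max_ideal_def
    by (intro ideal_gen_subset is_ideal_vars_ideal) (auto intro: var_in_vars_ideal)
  have J: "is_ideal n (max_ideal n :: 'k mpoly set)"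
    unfolding max_ideal_def by (intro is_ideal_ideal_gen) (auto intro: poly_ring_intros)
  show "vars_ideal n {..<n} \<subseteq> (max_ideal n :: 'k mpoly set)"
  proof
    fix p :: "'k mpoly" assume p: "p \<in> vars_ideal n {..<n}"
    show "p \<in> max_ideal n"
    proof (rule poly_in_idealI[OF J])
      fix m :: "nat \<Rightarrow>\<^sub>0 nat" and c :: 'k assume "m \<in> keys p"
      then obtain i where "i \<in> keys m" "i < n" "keys m \<subseteq> {..<n}"
        using p unfolding vars_ideal_def poly_ring_def by blast
      then show "single m c \<in> max_ideal n"
        using ideal_gen_superset[of "var ` {..<n}" n]
        by (intro single_in_idealI[OF J, of m i]) (auto simp: max_ideal_def)
    qed
  qed
qed

subsection \<open>Upper bound for the Krull dimension\<close>

text \<open>Gaussian elimination by induction on the set \<open>E\<close> of equations: the equation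
  \<open>e\<close> is used to eliminate one unknown \<open>j0\<close> from all the others.\<close>

lemma homogeneous_system_nontrivial_solution:
  fixes a :: "'j \<Rightarrow> 'e \<Rightarrow> 'k::field"
  assumes "finite E" "finite J" "card E < card J"
  shows "\<exists>c. (\<exists>j\<in>J. c j \<noteq> 0) \<and> (\<forall>e\<in>E. (\<Sum>j\<in>J. c j * a j e) = 0)"
  using assms
proof (induction E arbitrary: J a rule: finite_induct)
  case empty
  then have "J \<noteq> {}" by auto
  then show ?case by (intro exI[of _ "\<lambda>_. 1"]) auto
next
  case (insert e E)
  show ?case
  proof (cases "\<forall>j\<in>J. a j e = 0")
    case True
    have "card E < card J" using insert.hyps insert.prems by simp
    from insert.IH[OF insert.prems(1) this, of a] True show ?thesis by auto
  next
    case False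
    then obtain j0 where j0: "j0 \<in> J" "a j0 e \<noteq> 0" by auto
    define J' where "J' = J - {j0}"
    have J': "finite J'" "j0 \<notin> J'" "J = insert j0 J'"
      using j0 insert.prems by (auto simp: J'_def)
    have "card E < card J'" using insert.hyps insert.prems j0 by (simp add: J'_def)
    from insert.IH[OF J'(1) this, of "\<lambda>j x. a j x - a j e / a j0 e * a j0 x"]
    obtain c where c: "\<exists>j\<in>J'. c j \<noteq> 0"
      "\<And>x. x \<in> E \<Longrightarrow> (\<Sum>j\<in>J'. c j * (a j x - a j e / a j0 e * a j0 x)) = 0" by blast
    define s where "s = (\<Sum>j\<in>J'. c j * a j e)"
    \<comment> \<open>The value at \<open>j0\<close> is forced by equation \<open>e\<close>.\<close>
    define c' where "c' = c(j0 := - s / a j0 e)"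
    have c': "(\<Sum>j\<in>J. c' j * a j x) = - s / a j0 e * a j0 x + (\<Sum>j\<in>J'. c j * a j x)" for x
    proof -
      have "(\<Sum>j\<in>J'. c' j * a j x) = (\<Sum>j\<in>J'. c j * a j x)"
        using J' by (intro sum.cong) (auto simp: c'_def)
      then show ?thesis using J' by (simp add: c'_def)
    qed
    have "(\<Sum>j\<in>J. c' j * a j x) = 0" if "x \<in> insert e E" for x
    proof (cases "x = e")
      case True
      then show ?thesis unfolding c' using j0 by (simp add: s_def)
    next
      case False
      then have "0 = (\<Sum>j\<in>J'. c j * (a j x - a j e / a j0 e * a j0 x))" using that c(2) by simp
      also have "\<dots> = (\<Sum>j\<in>J'. c j * a j x) - (\<Sum>j\<in>J'. c j * a j e * (a j0 x / a j0 e))"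
        by (simp add: algebra_simps sum_subtractf)
      also have "(\<Sum>j\<in>J'. c j * a j e * (a j0 x / a j0 e)) = s * (a j0 x / a j0 e)"
        unfolding s_def by (rule sum_distrib_right[symmetric])
      finally show ?thesis unfolding c' by simp
    qed
    moreover have "\<exists>j\<in>J. c' j \<noteq> 0"
      using c(1) J' by (metis c'_def fun_upd_other insertCI)
    ultimately show ?thesis by blast
  qed
qed

text \<open>A bound for each variable instead of one for the total degree: the bounds still add up
  under products, and the monomials within the bound form a box, which is easy to count.\<close>

definition exps_le :: "nat \<Rightarrow> 'k::zero mpoly \<Rightarrow> bool" where
  "exps_le B p \<longleftrightarrow> (\<forall>m\<in>keys p. \<forall>i. lookup m i \<le> B)"

lemma exps_le_mult: "exps_le B p \<Longrightarrow> exps_le C q \<Longrightarrow> exps_le (B + C) (p * q :: 'k::field mpoly)"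
  unfolding exps_le_def using keys_mult[of p q] by (fastforce simp: lookup_add intro: add_mono)

lemma exps_le_power: "exps_le B p \<Longrightarrow> exps_le (k * B) (p ^ k :: 'k::field mpoly)"
proof (induction k)
  case 0
  then show ?case by (simp add: exps_le_def)
next
  case (Suc k)
  then show ?case using exps_le_mult[of B p "k * B" "p ^ k"] by simp
qed

lemma exps_le_prod:
  "finite A \<Longrightarrow> (\<And>x. x \<in> A \<Longrightarrow> exps_le (B x) (f x)) \<Longrightarrow> exps_le (sum B A) (prod f A :: 'k::field mpoly)"
proof (induction A rule: finite_induct)
  case empty
  then show ?case by (simp add: exps_le_def)
qed (simp add: exps_le_mult)

lemma exps_le_mono: "exps_le B p \<Longrightarrow> B \<le> C \<Longrightarrow> exps_le C p"
  unfolding exps_le_def by (meson order_trans)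

lemma ex_exps_le: "\<exists>B. exps_le B p"
proof -
  define B where "B = Max (insert 0 ((\<lambda>(m, i). lookup m i) ` (SIGMA m : keys p. keys m)))"
  have fin: "finite ((\<lambda>(m, i). lookup m i) ` (SIGMA m : keys p. keys m))" by simp
  have "lookup m i \<le> B" if "m \<in> keys p" for m i
  proof (cases "i \<in> keys m")
    case True
    then have "lookup m i \<in> (\<lambda>(m, i). lookup m i) ` (SIGMA m : keys p. keys m)"
      using that by force
    then show ?thesis unfolding B_def using fin by (intro Max_ge) auto
  qed (simp add: in_keys_iff)
  then show ?thesis by (auto simp: exps_le_def)
qed

lemma card_bounded_monomials:
  assumes "finite F"
  shows "finite {m :: nat \<Rightarrow>\<^sub>0 nat. keys m \<subseteq> F \<and> (\<forall>i. lookup m i \<le> B)}" (is "finite ?E")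
    and "card {m :: nat \<Rightarrow>\<^sub>0 nat. keys m \<subseteq> F \<and> (\<forall>i. lookup m i \<le> B)} \<le> (B + 1) ^ card F"
proof -
  let ?f = "\<lambda>m :: nat \<Rightarrow>\<^sub>0 nat. restrict (lookup m) F"
  let ?X = "F \<rightarrow>\<^sub>E {..B}"
  have inj: "inj_on ?f ?E"
  proof
    fix m m' assume *: "m \<in> ?E" "m' \<in> ?E" "?f m = ?f m'"
    show "m = m'"
    proof (rule poly_mapping_eqI)
      fix i show "lookup m i = lookup m' i"
      proof (cases "i \<in> F")
        case True
        then show ?thesis using fun_cong[OF *(3), of i] by simp
      next
        case False
        then have "i \<notin> keys m" "i \<notin> keys m'" using * by auto
        then show ?thesis by (simp add: in_keys_iff)
      qed
    qed
  qed
  have sub: "?f ` ?E \<subseteq> ?X" by (auto simp: PiE_iff)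
  have fin: "finite ?X" using assms by (intro finite_PiE) auto
  show "finite ?E" using inj_on_finite[OF inj sub fin] .
  show "card ?E \<le> (B + 1) ^ card F"
    using card_inj_on_le[OF inj sub fin] assms by (simp add: card_PiE)
qed

text \<open>The number of products of powers of the \<open>y i\<close> with exponents at most \<open>N\<close> grows like
  \<open>N ^ k\<close>, the number of monomials in the variables from \<open>F\<close> available to them only
  like \<open>N ^ card F\<close>.\<close>
lemma algebraic_dependence_mod_vars:
  fixes y :: "nat \<Rightarrow> 'k::field mpoly"
  assumes F: "finite F" "card F < k"
  obtains N :: nat and c :: "(nat \<Rightarrow> nat) \<Rightarrow> 'k"
  where "\<exists>j\<in>{..<k} \<rightarrow>\<^sub>E {..N}. c j \<noteq> 0"
    and "\<And>m. keys m \<subseteq> F \<Longrightarrow>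
      lookup (\<Sum>j\<in>{..<k} \<rightarrow>\<^sub>E {..N}. single 0 (c j) * (\<Prod>i<k. y i ^ j i)) m = 0"
proof -
  have "\<forall>i. \<exists>B. exps_le B (y i)" by (simp add: ex_exps_le)
  then obtain D0 where D0: "\<And>i. exps_le (D0 i) (y i)" by metis
  define D where "D = (\<Sum>i<k. D0 i)"
  have D: "exps_le D (y i)" if "i < k" for i
    by (rule exps_le_mono[OF D0]) (use that in \<open>auto simp: D_def intro: member_le_sum\<close>)
  \<comment> \<open>\<open>B\<close> bounds the exponents in a product of \<open>k\<close> powers of
    exponent at most \<open>N\<close>. \<open>C\<close> is chosen so that
    \<open>B + 1 \<le> C * (N + 1)\<close>, and \<open>N\<close> so that the resulting factor
    \<open>C ^ card F\<close> is absorbed by one more power of \<open>N + 1\<close>.\<close>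
  define C where "C = k * D + 1"
  define N where "N = C ^ card F"
  define B where "B = k * (N * D)"
  let ?J = "{..<k} \<rightarrow>\<^sub>E {..N}"
  let ?E = "{m :: nat \<Rightarrow>\<^sub>0 nat. keys m \<subseteq> F \<and> (\<forall>i. lookup m i \<le> B)}"
  have "exps_le B (\<Prod>i<k. y i ^ j i)" if "j \<in> ?J" for j
  proof -
    have "exps_le (N * D) (y i ^ j i)" if "i < k" for i
    proof -
      have "j i \<le> N" using \<open>j \<in> ?J\<close> that by auto
      then show ?thesis using exps_le_mono[OF exps_le_power[OF D[OF that]]] by simp
    qed
    then show ?thesis using exps_le_prod[of "{..<k}" "\<lambda>_. N * D" "\<lambda>i. y i ^ j i"] by (simp add: B_def)
  qed
  then have zero: "lookup (\<Prod>i<k. y i ^ j i) m = 0"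
    if "j \<in> ?J" "\<not> (\<forall>i. lookup m i \<le> B)" for j m
    using that unfolding exps_le_def by (meson not_in_keys_iff_lookup_eq_zero)
  have "B + 1 \<le> C * (N + 1)" by (simp add: B_def C_def algebra_simps)
  then have "(B + 1) ^ card F \<le> (C * (N + 1)) ^ card F" by (rule power_mono) simp
  also have "\<dots> = N * (N + 1) ^ card F" unfolding N_def by (rule power_mult_distrib)
  also have "\<dots> < (N + 1) ^ Suc (card F)" by simp
  also have "\<dots> \<le> (N + 1) ^ k" using F by (intro power_increasing) auto
  also have "\<dots> = card ?J" by (simp add: card_PiE)
  finally have "card ?E < card ?J"
    using card_bounded_monomials(2)[OF F(1), of B] by linarith
  from homogeneous_system_nontrivial_solution[OF card_bounded_monomials(1)[OF F(1)] _ this,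
      of "\<lambda>j m. lookup (\<Prod>i<k. y i ^ j i) m"]
  obtain c where c: "\<exists>j\<in>?J. c j \<noteq> 0"
    "\<And>m. m \<in> ?E \<Longrightarrow> (\<Sum>j\<in>?J. c j * lookup (\<Prod>i<k. y i ^ j i) m) = 0"
    by (auto intro: finite_PiE)
  have "lookup (\<Sum>j\<in>?J. single 0 (c j) * (\<Prod>i<k. y i ^ j i)) m = 0" if "keys m \<subseteq> F" for m
  proof -
    have "lookup (\<Sum>j\<in>?J. single 0 (c j) * (\<Prod>i<k. y i ^ j i)) m
        = (\<Sum>j\<in>?J. c j * lookup (\<Prod>i<k. y i ^ j i) m)"
      by (simp add: lookup_sum lookup_mult_const)
    also have "\<dots> = 0"
    proof (cases "\<forall>i. lookup m i \<le> B")
      case True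
      then show ?thesis using c(2) that by simp
    next
      case False
      then show ?thesis using zero by (intro sum.neutral) auto
    qed
    finally show ?thesis .
  qed
  then show ?thesis using that c(1) by blast
qed

text \<open>The terms of a relation with the lowest power of \<open>y 0\<close>, among these the terms with
  the lowest power of \<open>y 1\<close>, and so on: passing from \<open>Q t\<close> to \<open>Q (Suc t)\<close> kills everything
  but the terms with the lowest power of \<open>y t\<close>.\<close>
lemma prime_chain_no_relation:
  fixes y :: "nat \<Rightarrow> 'k::field mpoly"
  assumes Q: "\<And>i. i \<le> k \<Longrightarrow> prime_ideal n (Q i)"
    and y: "\<And>i. i < k \<Longrightarrow> y i \<in> Q (Suc i) - Q i"
    and mono: "\<And>i. i < k \<Longrightarrow> Q i \<subseteq> Q (Suc i)"
    and J: "finite J" "\<exists>j\<in>J. c j \<noteq> 0"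
    and inj: "\<And>j j'. j \<in> J \<Longrightarrow> j' \<in> J \<Longrightarrow> (\<And>i. i < k \<Longrightarrow> j i = j' i) \<Longrightarrow> j = j'"
    and rel: "(\<Sum>j\<in>J. single 0 (c j) * (\<Prod>i<k. y i ^ j i)) \<in> Q 0"
  shows False
proof -
  have yring: "y i \<in> poly_ring n" if "i < k" for i
    using y[OF that] Q[of "Suc i"] that by (auto dest: prime_idealD(1) is_idealD(1))
  have const: "single 0 x \<in> poly_ring n" for x :: 'k by (simp add: poly_ring_single)
  \<comment> \<open>The surviving exponent vectors remain distinguishable by their entries from
    \<open>t\<close> on. At \<open>t = k\<close> no entries are left, so one vector survives and the
    relation is a nonzero constant in \<open>Q k\<close>.\<close>
  have "\<exists>K. finite K \<and> K \<noteq> {} \<and> (\<forall>j\<in>K. c j \<noteq> 0)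
    \<and> (\<forall>j\<in>K. \<forall>j'\<in>K. (\<forall>i\<in>{t..<k}. j i = j' i) \<longrightarrow> j = j')
    \<and> (\<Sum>j\<in>K. single 0 (c j) * (\<Prod>i\<in>{t..<k}. y i ^ j i)) \<in> Q t" if "t \<le> k" for t
    using that
  proof (induction t)
    case 0
    let ?K = "{j \<in> J. c j \<noteq> 0}"
    have "(\<Sum>j\<in>J. single 0 (c j) * (\<Prod>i<k. y i ^ j i))
        = (\<Sum>j\<in>?K. single 0 (c j) * (\<Prod>i<k. y i ^ j i))"
      using J by (intro sum.mono_neutral_right) auto
    then show ?case
      using J inj rel by (intro exI[of _ ?K]) (auto simp: lessThan_atLeast0)
  next
    case (Suc t)
    then obtain K where K: "finite K" "K \<noteq> {}" "\<forall>j\<in>K. c j \<noteq> 0"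
      "\<forall>j\<in>K. \<forall>j'\<in>K. (\<forall>i\<in>{t..<k}. j i = j' i) \<longrightarrow> j = j'"
      "(\<Sum>j\<in>K. single 0 (c j) * (\<Prod>i\<in>{t..<k}. y i ^ j i)) \<in> Q t" by auto
    have t: "t < k" using Suc.prems by simp
    define \<mu> where "\<mu> = Min ((\<lambda>j. j t) ` K)"
    have \<mu>: "\<mu> \<le> j t" if "j \<in> K" for j using that K by (simp add: \<mu>_def)
    have "\<mu> \<in> (\<lambda>j. j t) ` K" unfolding \<mu>_def using K by (intro Min_in) auto
    define L where "L = {j \<in> K. j t = \<mu>}"
    have L: "L \<noteq> {}" "L \<subseteq> K" "finite L" using \<open>\<mu> \<in> _\<close> K by (auto simp: L_def)
    define T where "T = (\<lambda>j. single 0 (c j) * (\<Prod>i\<in>{Suc t..<k}. y i ^ j i))"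
    have T: "T j \<in> poly_ring n" for j
      unfolding T_def by (intro poly_ring_intros const yring) auto
    \<comment> \<open>Outside \<open>L\<close> the exponent exceeds \<mu>, so a further factor
      \<open>y t\<close> can be taken out; it moves these terms into
      \<open>Q (Suc t)\<close>.\<close>
    define h where "h = (\<Sum>j\<in>K - L. y t ^ (j t - Suc \<mu>) * T j)"
    have h: "h \<in> poly_ring n" unfolding h_def using t by (intro poly_ring_intros T yring)
    have "(\<Sum>j\<in>K. single 0 (c j) * (\<Prod>i\<in>{t..<k}. y i ^ j i)) = (\<Sum>j\<in>K. y t ^ j t * T j)"
      unfolding T_def prod.atLeast_Suc_lessThan[OF t] by (intro sum.cong refl mult.left_commute)
    also have "\<dots> = (\<Sum>j\<in>L. y t ^ j t * T j) + (\<Sum>j\<in>K - L. y t ^ j t * T j)"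
      by (simp add: sum.subset_diff[OF L(2) K(1)])
    also have "(\<Sum>j\<in>L. y t ^ j t * T j) = y t ^ \<mu> * (\<Sum>j\<in>L. T j)"
      by (simp add: L_def sum_distrib_left)
    also have "(\<Sum>j\<in>K - L. y t ^ j t * T j) = y t ^ \<mu> * (y t * h)"
    proof -
      have "y t ^ j t * T j = y t ^ \<mu> * (y t * (y t ^ (j t - Suc \<mu>) * T j))" if "j \<in> K - L" for j
      proof -
        have "j t = \<mu> + Suc (j t - Suc \<mu>)" using that \<mu>[of j] by (auto simp: L_def)
        then have "y t ^ j t = y t ^ \<mu> * (y t * y t ^ (j t - Suc \<mu>))"
          by (metis power_Suc power_add)
        then show ?thesis by (simp add: mult.assoc)
      qed
      then show ?thesis unfolding h_def sum_distrib_left by (rule sum.cong[OF refl])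
    qed
    finally have "y t ^ \<mu> * ((\<Sum>j\<in>L. T j) + y t * h) \<in> Q t"
      using K(5) by (simp add: distrib_left)
    \<comment> \<open>The common factor can be cancelled because \<open>Q t\<close> is prime and
      \<open>y t\<close> lies outside it.\<close>
    moreover have "p \<in> Q t" if "y t ^ e * p \<in> Q t" "p \<in> poly_ring n" for e p
      using that
    proof (induction e)
      case (Suc e)
      then show ?case
        using prime_idealD(3)[OF Q[of t], of "y t" "y t ^ e * p"] y[OF t] t
        by (auto simp: mult.assoc intro!: poly_ring_intros yring)
    qed simp
    moreover have "(\<Sum>j\<in>L. T j) + y t * h \<in> poly_ring n"
      using t by (intro poly_ring_intros T h yring)
    ultimately have "(\<Sum>j\<in>L. T j) + y t * h \<in> Q (Suc t)" using mono[OF t] by blast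
    moreover have Qt: "is_ideal n (Q (Suc t))" using Q t by (simp add: prime_idealD(1))
    moreover have "y t * h \<in> Q (Suc t)" using y[OF t] h by (auto intro: is_idealD(5)[OF Qt])
    ultimately have "(\<Sum>j\<in>L. T j) \<in> Q (Suc t)" using is_ideal_diff[OF Qt] by fastforce
    moreover have "j = j'" if "j \<in> L" "j' \<in> L" "\<forall>i\<in>{Suc t..<k}. j i = j' i" for j j'
    proof -
      have "\<forall>i\<in>insert t {Suc t..<k}. j i = j' i"
        using that by (simp add: L_def)
      also have "insert t {Suc t..<k} = {t..<k}" using t by auto
      finally show ?thesis using K(4) L(2) that(1,2) by blast
    qed
    ultimately show ?case
      using K(3) L unfolding T_def by (intro exI[of _ L]) blast
  qed
  from this[of k] obtain K where K: "finite K" "K \<noteq> {}" "\<forall>j\<in>K. c j \<noteq> 0"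
    "\<forall>j\<in>K. \<forall>j'\<in>K. j = j'" "(\<Sum>j\<in>K. single 0 (c j)) \<in> Q k" by auto
  then obtain j where j: "K = {j}" "c j \<noteq> 0" by blast
  have Qk: "is_ideal n (Q k)" using Q by (simp add: prime_idealD(1))
  have "single 0 (1 / c j) * single 0 (c j) \<in> Q k"
    using K j by (intro is_idealD(4)[OF Qk] const) auto
  then have "1 \<in> Q k" using j by (simp add: mult_single)
  then show False using prime_idealD(2)[OF Q[of k]] by simp
qed

text \<open>Only the variables outside \<open>Q 0\<close> count. If there are fewer than
  \<open>k\<close> of them, elements picked from the \<open>k\<close> successive differences satisfy
  a relation up to monomials containing a variable of \<open>Q 0\<close>, that is, a relation modulo
  \<open>Q 0\<close>.\<close>

lemma prime_chain_le:
  assumes chain: "prime_chain n I k"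
    and d: "\<And>Q. prime_ideal n Q \<Longrightarrow> I \<subseteq> Q \<Longrightarrow> card {i. i < n \<and> var i \<notin> Q} \<le> d"
  shows "k \<le> d"
proof (rule ccontr)
  assume "\<not> k \<le> d"
  from chain obtain Q :: "nat \<Rightarrow> 'a mpoly set"
    where Q: "\<And>i. i \<le> k \<Longrightarrow> prime_ideal n (Q i)" "\<And>i. i \<le> k \<Longrightarrow> I \<subseteq> Q i"
      and lt: "\<And>i. i < k \<Longrightarrow> Q i \<subset> Q (Suc i)"
    unfolding prime_chain_def by blast
  have "\<exists>y. y \<in> Q (Suc i) - Q i" if "i < k" for i
    using lt[OF that] by blast
  then obtain y where y: "\<And>i. i < k \<Longrightarrow> y i \<in> Q (Suc i) - Q i" by metis
  define F where "F = {i. i < n \<and> var i \<notin> Q 0}"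
  have F: "finite F" "card F < k"
    using d[OF Q(1) Q(2), of 0] \<open>\<not> k \<le> d\<close> by (auto simp: F_def)
  from algebraic_dependence_mod_vars[OF F, of y]
  obtain N c where c: "\<exists>j\<in>{..<k} \<rightarrow>\<^sub>E {..N}. c j \<noteq> 0"
    "\<And>m. keys m \<subseteq> F \<Longrightarrow>
      lookup (\<Sum>j\<in>{..<k} \<rightarrow>\<^sub>E {..N}. single 0 (c j) * (\<Prod>i<k. y i ^ j i)) m = 0" by blast
  let ?r = "\<Sum>j\<in>{..<k} \<rightarrow>\<^sub>E {..N}. single 0 (c j) * (\<Prod>i<k. y i ^ j i)"
  have yring: "y i \<in> poly_ring n" if "i < k" for i
    using y[OF that] Q(1)[of "Suc i"] that by (auto dest: prime_idealD(1) is_idealD(1))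
  have r: "?r \<in> poly_ring n"
    by (intro poly_ring_intros poly_ring_single yring) auto
  have Q0: "is_ideal n (Q 0)" using Q(1) by (simp add: prime_idealD(1))
  have "?r \<in> Q 0"
  proof (rule poly_in_idealI[OF Q0])
    fix m :: "nat \<Rightarrow>\<^sub>0 nat" and x :: 'a assume m: "m \<in> keys ?r"
    then have "\<not> keys m \<subseteq> F" using c(2)[of m] by (auto simp: in_keys_iff)
    moreover have "keys m \<subseteq> {..<n}" using r m unfolding poly_ring_def by blast
    ultimately obtain i where "i \<in> keys m" "var i \<in> Q 0" by (auto simp: F_def)
    then show "single m x \<in> Q 0" by (rule single_in_idealI[OF Q0 \<open>keys m \<subseteq> {..<n}\<close>])
  qed
  moreover have "j = j'" if "j \<in> {..<k} \<rightarrow>\<^sub>E {..N}" "j' \<in> {..<k} \<rightarrow>\<^sub>E {..N}"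
    "\<And>i. i < k \<Longrightarrow> j i = j' i" for j j'
    using that by (metis PiE_ext lessThan_iff)
  moreover have "finite ({..<k} \<rightarrow>\<^sub>E {..N})" by (intro finite_PiE) auto
  moreover have "Q i \<subseteq> Q (Suc i)" if "i < k" for i using lt[OF that] by simp
  ultimately show False
    using prime_chain_no_relation[of k n Q y "{..<k} \<rightarrow>\<^sub>E {..N}" c, OF Q(1) y] c(1) by blast
qed

subsection \<open>Regular sequences and chains of primes\<close>

lemma is_ideal_Union_chain:
  fixes \<C> :: "'k::field mpoly set set"
  assumes "\<C> \<noteq> {}" "subset.chain A \<C>" "\<And>K. K \<in> \<C> \<Longrightarrow> is_ideal n K"
  shows "is_ideal n (\<Union>\<C>)"
  unfolding is_ideal_def
proof (intro conjI ballI)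
  show "\<Union>\<C> \<subseteq> poly_ring n" using assms(3) is_idealD(1) by blast
  show "0 \<in> \<Union>\<C>" using assms(1,3) is_idealD(2) by blast
next
  fix a b :: "'k mpoly" assume "a \<in> \<Union>\<C>" "b \<in> \<Union>\<C>"
  then obtain K L where KL: "a \<in> K" "K \<in> \<C>" "b \<in> L" "L \<in> \<C>" by blast
  then have "K \<subseteq> L \<or> L \<subseteq> K" using assms(2) by (auto simp: subset.chain_def)
  then show "a + b \<in> \<Union>\<C>"
    using KL assms(3) is_idealD(3) by (metis UnionI subsetD)
next
  fix p a :: "'k mpoly" assume "p \<in> poly_ring n" "a \<in> \<Union>\<C>"
  then show "p * a \<in> \<Union>\<C>" using assms(3) is_idealD(4) by blast
qed

text \<open>Krull's argument: by Zorn there is an ideal maximal among those that avoid the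
  multiplicative set \<open>M\<close>, and maximality makes it prime.\<close>

lemma ex_prime_ideal_avoiding:
  assumes J: "is_ideal n J" and M: "1 \<in> M" "\<And>a b. a \<in> M \<Longrightarrow> b \<in> M \<Longrightarrow> a * b \<in> M"
    and disj: "J \<inter> M = {}"
  obtains Q where "prime_ideal n Q" "J \<subseteq> Q" "Q \<inter> M = {}"
proof -
  define \<A> where "\<A> = {K. is_ideal n K \<and> J \<subseteq> K \<and> K \<inter> M = {}}"
  have "\<A> \<noteq> {}" using J disj by (auto simp: \<A>_def)
  moreover have "\<Union>\<C> \<in> \<A>" if C: "\<C> \<noteq> {}" "subset.chain \<A> \<C>" for \<C>
  proof -
    have "\<C> \<subseteq> \<A>" using C(2) by (auto simp: subset.chain_def)
    then show ?thesis
      using C is_ideal_Union_chain[OF C] by (fastforce simp: \<A>_def)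
  qed
  ultimately obtain Q where Q: "Q \<in> \<A>" and max: "\<And>X. X \<in> \<A> \<Longrightarrow> Q \<subseteq> X \<Longrightarrow> X = Q"
    using subset_Zorn_nonempty[of \<A>] by blast
  have Qi: "is_ideal n Q" and QJ: "J \<subseteq> Q" and QM: "Q \<inter> M = {}" using Q by (auto simp: \<A>_def)
  have meets: "\<exists>q h. q \<in> Q \<and> h \<in> poly_ring n \<and> q + a * h \<in> M"
    if a: "a \<in> poly_ring n" "a \<notin> Q" for a
  proof (rule ccontr)
    assume no: "\<not> ?thesis"
    let ?K = "{q + a * h | q h. q \<in> Q \<and> h \<in> poly_ring n}"
    have "Q \<subseteq> ?K" using poly_ring_zero[of n] by force
    moreover have "is_ideal n ?K" using Qi a(1) by (rule is_ideal_insert)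
    ultimately have "?K \<in> \<A>" using QJ no by (auto simp: \<A>_def)
    from max[OF this \<open>Q \<subseteq> ?K\<close>] have "?K = Q" .
    moreover have "a \<in> ?K" using is_idealD(2)[OF Qi] poly_ring_one[of n] by force
    ultimately show False using a(2) by blast
  qed
  have "a \<in> Q \<or> b \<in> Q" if ab: "a \<in> poly_ring n" "b \<in> poly_ring n" "a * b \<in> Q" for a b
  proof (rule ccontr)
    assume "\<not> ?thesis"
    then obtain q h q' h' where *: "q \<in> Q" "h \<in> poly_ring n" "q + a * h \<in> M"
      "q' \<in> Q" "h' \<in> poly_ring n" "q' + b * h' \<in> M"
      using meets ab by meson
    \<comment> \<open>Each summand contains \<open>q\<close>, \<open>q'\<close> or
      \<open>a * b\<close>, while the product belongs to \<open>M\<close>.\<close>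
    have "(q + a * h) * (q' + b * h') = q * (q' + b * h') + (a * h) * q' + (h * h') * (a * b)"
      by (simp add: algebra_simps)
    also have "\<dots> \<in> Q"
      using * ab is_idealD(1)[OF Qi *(4)]
      by (intro is_idealD(3)[OF Qi] is_idealD(5)[OF Qi _ *(1)] is_idealD(4)[OF Qi _ *(4)]
          is_idealD(4)[OF Qi _ ab(3)] poly_ring_intros)
    finally show False using M(2)[OF *(3,6)] QM by blast
  qed
  moreover have "Q \<noteq> poly_ring n" using M(1) QM is_ideal_eq_poly_ring_iff[OF Qi] by blast
  ultimately have "prime_ideal n Q" using Qi by (auto simp: prime_ideal_def)
  then show ?thesis using that QJ QM by blast
qed

text \<open>The multiplicative set generated by \<open>f\<close> and the complement of \<open>P\<close> avoids \<open>J\<close>, because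
  powers of \<open>f\<close> can be cancelled modulo \<open>J\<close>.\<close>
lemma ex_smaller_prime_ideal:
  assumes J: "is_ideal n J" and P: "prime_ideal n P" "J \<subseteq> P" and f: "f \<in> P"
    and reg: "\<And>g. g \<in> poly_ring n \<Longrightarrow> f * g \<in> J \<Longrightarrow> g \<in> J"
  obtains Q where "prime_ideal n Q" "J \<subseteq> Q" "Q \<subset> P"
proof -
  note Pi = prime_idealD(1)[OF P(1)]
  have fr: "f \<in> poly_ring n" using is_idealD(1)[OF Pi f] .
  define M where "M = {s * f ^ k | s k. s \<in> poly_ring n - P}"
  have one: "1 \<in> poly_ring n - P" using prime_idealD(2)[OF P(1)] by (simp add: poly_ring_one)
  have "1 \<in> M" using one by (force simp: M_def intro: exI[of _ 0])
  moreover have "a * b \<in> M" if "a \<in> M" "b \<in> M" for a b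
  proof -
    from that obtain s k t l where *: "a = s * f ^ k" "s \<in> poly_ring n - P"
      "b = t * f ^ l" "t \<in> poly_ring n - P" unfolding M_def by blast
    then have "a * b = (s * t) * f ^ (k + l)" by (simp add: power_add algebra_simps)
    moreover have "s * t \<in> poly_ring n - P"
      using * prime_idealD(3)[OF P(1)] by (auto intro: poly_ring_intros)
    ultimately show ?thesis unfolding M_def by blast
  qed
  moreover have "s \<in> J" if "s \<in> poly_ring n" "s * f ^ k \<in> J" for s k
    using that(2)
  proof (induction k)
    case (Suc k)
    have "f * (s * f ^ k) \<in> J" using Suc.prems by (simp add: algebra_simps)
    moreover have "s * f ^ k \<in> poly_ring n" using that(1) fr by (intro poly_ring_intros)
    ultimately show ?case using reg Suc.IH by blast
  qed simp
  then have "J \<inter> M = {}" using P(2) unfolding M_def by blast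
  ultimately obtain Q where Q: "prime_ideal n Q" "J \<subseteq> Q" "Q \<inter> M = {}"
    using ex_prime_ideal_avoiding[OF J] by blast
  \<comment> \<open>\<open>M\<close> contains every ring element outside \<open>P\<close>, which
    gives the inclusion; it also contains \<open>f\<close>, which makes the inclusion
    strict.\<close>
  have "Q \<subseteq> P"
  proof
    fix s assume "s \<in> Q"
    then have "s \<in> poly_ring n" using Q(1) prime_idealD(1) is_idealD(1) by blast
    then show "s \<in> P" using \<open>s \<in> Q\<close> Q(3) by (force simp: M_def intro: exI[of _ 0])
  qed
  moreover have "f \<in> M" using one by (force simp: M_def intro: exI[of _ 1])
  then have "f \<notin> Q" using Q(3) by blast
  ultimately show ?thesis using that Q f by blast
qed

text \<open>The chain is built downwards from a prime over the ideal of the whole sequence. A prime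
  over \<open>J (Suc j)\<close> contains \<open>fs ! j\<close>, which is cancellable modulo
  \<open>J j\<close>, so there is a strictly smaller prime over \<open>J j\<close>.\<close>

lemma regular_seq_prime_chain:
  assumes I: "is_ideal n I" and reg: "regular_seq n I fs"
  shows "prime_chain n I (length fs)"
proof -
  define J where "J = (\<lambda>i. ideal_gen n (I \<union> set (take i fs)))"
  have max: "max_ideal n \<subseteq> poly_ring n"
    unfolding max_ideal_eq using is_ideal_vars_ideal is_idealD(1) by blast
  have J: "is_ideal n (J i)" for i
    unfolding J_def using reg I max
    by (intro is_ideal_ideal_gen) (auto simp: regular_seq_def dest: in_set_takeD is_idealD(1))
  have Jmono: "J i \<subseteq> J (Suc i)" for i
    unfolding J_def using set_take_subset_set_take[of i "Suc i" fs] by (intro ideal_gen_mono) auto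
  have "\<exists>Q. (\<forall>i. j \<le> i \<and> i \<le> length fs \<longrightarrow> prime_ideal n (Q i) \<and> J i \<subseteq> Q i)
    \<and> (\<forall>i. j \<le> i \<and> i < length fs \<longrightarrow> Q i \<subset> Q (Suc i))" if "j \<le> length fs" for j
    using that
  proof (induction rule: inc_induct)
    case base
    have "J (length fs) \<noteq> poly_ring n" using reg by (simp add: regular_seq_def J_def)
    \<comment> \<open>Avoiding the multiplicative set \<open>{1}\<close> amounts to being
      proper.\<close>
    then have "J (length fs) \<inter> {1} = {}" using is_ideal_eq_poly_ring_iff[OF J] by simp
    then obtain Q where "prime_ideal n Q" "J (length fs) \<subseteq> Q"
      by - (rule ex_prime_ideal_avoiding[OF J, where M = "{1}"], auto)
    then show ?case by (intro exI[of _ "\<lambda>_. Q"]) auto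
  next
    case (step j)
    from step.IH obtain Q
      where Q: "\<forall>i. Suc j \<le> i \<and> i \<le> length fs \<longrightarrow> prime_ideal n (Q i) \<and> J i \<subseteq> Q i"
        "\<forall>i. Suc j \<le> i \<and> i < length fs \<longrightarrow> Q i \<subset> Q (Suc i)" by (elim exE conjE)
    have "fs ! j \<in> J (Suc j)"
      using ideal_gen_superset[of "I \<union> set (take (Suc j) fs)" n] step(2)
      by (auto simp: J_def take_Suc_conv_app_nth)
    moreover have QS: "prime_ideal n (Q (Suc j))" "J (Suc j) \<subseteq> Q (Suc j)"
      using Q(1) step.hyps by auto
    ultimately have "fs ! j \<in> Q (Suc j)" by blast
    moreover have "g \<in> J j" if "g \<in> poly_ring n" "fs ! j * g \<in> J j" for g
      using reg that step.hyps by (auto simp: regular_seq_def J_def)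
    moreover have "J j \<subseteq> Q (Suc j)" using Jmono[of j] QS(2) by (rule order_trans)
    ultimately obtain R where R: "prime_ideal n R" "J j \<subseteq> R" "R \<subset> Q (Suc j)"
      using ex_smaller_prime_ideal[OF J[of j] QS(1)] by metis
    have "prime_ideal n ((Q(j := R)) i) \<and> J i \<subseteq> (Q(j := R)) i" if "j \<le> i" "i \<le> length fs" for i
      using R Q(1)[rule_format, of i] that by (cases "i = j") auto
    moreover have "(Q(j := R)) i \<subset> (Q(j := R)) (Suc i)" if "j \<le> i" "i < length fs" for i
      using R Q(2)[rule_format, of i] that by (cases "i = j") auto
    ultimately show ?case by (intro exI[of _ "Q(j := R)"]) blast
  qed
  from this[of 0] obtain Q where Q: "\<And>i. i \<le> length fs \<Longrightarrow> prime_ideal n (Q i) \<and> J i \<subseteq> Q i"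
    "\<And>i. i < length fs \<Longrightarrow> Q i \<subset> Q (Suc i)" by auto
  moreover have "I \<subseteq> J i" for i
    unfolding J_def using ideal_gen_superset[of "I \<union> set (take i fs)" n] by blast
  ultimately show ?thesis
    unfolding prime_chain_def by (intro exI[of _ Q]) blast
qed

subsection \<open>Edge ideals and the dimension of the independence complex\<close>

lemma is_ideal_edge_ideal: "is_ideal n (edge_ideal n E)"
  unfolding edge_ideal_def by (intro is_ideal_ideal_gen) (auto intro: poly_ring_intros)

lemma var_mult_in_edge_ideal: "i < n \<Longrightarrow> j < n \<Longrightarrow> E i j \<Longrightarrow> var i * var j \<in> edge_ideal n E"
  unfolding edge_ideal_def
  using ideal_gen_superset[of "{var i * var j |i j. i < n \<and> j < n \<and> E i j}" n] by blast

lemma edge_ideal_subset_vars_ideal: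
  assumes "independent_set {..<n} E F"
  shows "edge_ideal n E \<subseteq> vars_ideal n ({..<n} - F)"
  unfolding edge_ideal_def
proof (intro ideal_gen_subset is_ideal_vars_ideal subsetI)
  fix p :: "'a mpoly" assume "p \<in> {var i * var j |i j. i < n \<and> j < n \<and> E i j}"
  then obtain i j where ij: "p = var i * var j" "i < n" "j < n" "E i j" by blast
  then have "i \<notin> F \<or> j \<notin> F" using assms by (auto simp: independent_set_def)
  then show "p \<in> vars_ideal n ({..<n} - F)"
    using ij by (auto intro: is_idealD(4,5)[OF is_ideal_vars_ideal] poly_ring_var var_in_vars_ideal)
qed

lemma lookup_edge_ideal:
  "p \<in> edge_ideal n E \<Longrightarrow> independent_set {..<n} E (keys m) \<Longrightarrow> lookup p m = 0"
  using edge_ideal_subset_vars_ideal[of n E "keys m"] by (auto intro: vars_ideal_lookup)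

text \<open>Together with \<open>lookup_edge_ideal\<close> this identifies the edge ideal with the
  Stanley-Reisner ideal of the complex. Irreflexivity matters: a loop at \<open>u\<close> would
  contribute only the square of \<open>var u\<close>, which need not divide the monomial.\<close>

lemma in_edge_idealI:
  assumes irrefl: "\<And>i. \<not> E i i" and p: "p \<in> poly_ring n"
    and nonface: "\<And>m. m \<in> keys p \<Longrightarrow> \<not> independent_set {..<n} E (keys m)"
  shows "p \<in> edge_ideal n E"
proof (rule poly_in_idealI[OF is_ideal_edge_ideal])
  fix m :: "nat \<Rightarrow>\<^sub>0 nat" and c :: 'a assume m: "m \<in> keys p"
  then have mn: "keys m \<subseteq> {..<n}" using p unfolding poly_ring_def by blast
  then obtain u v where uv: "u \<in> keys m" "v \<in> keys m" "E u v" "u \<noteq> v"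
    using nonface[OF m] irrefl by (auto simp: independent_set_def)
  define m' where "m' = m - (single u 1 + single v 1)"
  have m_eq: "m = m' + (single u 1 + single v 1)"
    by (rule poly_mapping_eqI)
      (use uv in \<open>auto simp: m'_def lookup_add lookup_minus lookup_single when_def in_keys_iff\<close>)
  have "keys m' \<subseteq> {..<n}" using mn m_eq keys_add_nat by (metis Un_subset_iff)
  then have "single m' c * (var u * var v) \<in> edge_ideal n E"
    using uv mn
    by (intro is_idealD(4)[OF is_ideal_edge_ideal] poly_ring_single var_mult_in_edge_ideal) auto
  also have "single m' c * (var u * var v) = single m c"
    unfolding var_def by (subst m_eq) (simp add: mult_single)
  finally show "single m c \<in> edge_ideal n E" .
qed

text \<open>An edge puts the product of its two variables into \<open>Q\<close>, hence one of them.
  This supplies the bound required by \<open>prime_chain_le\<close>.\<close>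

lemma independent_set_vars_notin_prime:
  assumes "prime_ideal n Q" "edge_ideal n E \<subseteq> Q"
  shows "independent_set {..<n} E {i. i < n \<and> var i \<notin> Q}"
  unfolding independent_set_def
  using assms var_mult_in_edge_ideal[of _ n _ E] prime_idealD(3)[OF assms(1)]
  by (blast intro: poly_ring_var)

text \<open>The chain starts with the variables outside \<open>F\<close> and adjoins the vertices of
  \<open>F\<close> one at a time.\<close>

lemma prime_chain_independent_set:
  assumes F: "independent_set {..<n} E F"
  shows "prime_chain n (edge_ideal n E :: 'k::field mpoly set) (card F)"
proof -
  have Fn: "F \<subseteq> {..<n}" using F by (simp add: independent_set_def)
  then obtain xs where xs: "set xs = F" "distinct xs"
    using finite_distinct_list[of F] finite_subset by blast
  define A where "A = (\<lambda>i. ({..<n} - F) \<union> set (take i xs))"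
  have len: "length xs = card F" using xs distinct_card by metis
  have "vars_ideal n (A i) \<subset> (vars_ideal n (A (Suc i)) :: 'k mpoly set)" if "i < length xs" for i
  proof
    show "vars_ideal n (A i) \<subseteq> (vars_ideal n (A (Suc i)) :: 'k mpoly set)"
      unfolding A_def using set_take_subset_set_take[of i "Suc i" xs] by (intro vars_ideal_mono) auto
    have "xs ! i \<in> A (Suc i)" using that by (simp add: A_def take_Suc_conv_app_nth)
    moreover have "xs ! i \<in> F" using that xs by auto
    ultimately have "(var (xs ! i) :: 'k mpoly) \<in> vars_ideal n (A (Suc i))"
      using Fn by (intro var_in_vars_ideal) auto
    moreover have "xs ! i \<notin> A i"
      using that xs \<open>xs ! i \<in> F\<close> by (auto simp: A_def in_set_conv_nth nth_eq_iff_index_eq)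
    then have "(var (xs ! i) :: 'k mpoly) \<notin> vars_ideal n (A i)"
      by (simp add: vars_ideal_def var_def)
    ultimately show "vars_ideal n (A i) \<noteq> (vars_ideal n (A (Suc i)) :: 'k mpoly set)" by blast
  qed
  moreover have "edge_ideal n E \<subseteq> (vars_ideal n (A i) :: 'k mpoly set)" for i
    using edge_ideal_subset_vars_ideal[OF F] vars_ideal_mono[of "{..<n} - F" "A i" n]
    by (auto simp: A_def)
  ultimately show ?thesis
    unfolding prime_chain_def len[symmetric] using prime_ideal_vars_ideal
    by (intro exI[of _ "\<lambda>i. vars_ideal n (A i)"]) blast
qed

section \<open>Faces, Krull dimension and depth\<close>

lemma finite_independent_sets: "finite V \<Longrightarrow> finite {F. independent_set V E F}"
  by (rule finite_subset[of _ "Pow V"]) (auto simp: independent_set_def)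

lemma card_independent_set_le:
  assumes "independent_set {..<n} E F"
  shows "int (card F) \<le> indep_complex_dim {..<n} E + 1"
  unfolding indep_complex_dim_def
  using assms by (auto intro!: Max_ge finite_independent_sets)

lemma ex_independent_set_card:
  assumes "finite V"
  obtains F where "independent_set V E F" "int (card F) = indep_complex_dim V E + 1"
proof -
  have "Max (card ` {F. independent_set V E F}) \<in> card ` {F. independent_set V E F}"
    using assms by (intro Max_in finite_imageI finite_independent_sets)
      (auto simp: independent_set_def)
  then show ?thesis using that by (auto simp: indep_complex_dim_def)
qed

lemma prime_chain_edge_ideal_le:
  assumes "prime_chain n (edge_ideal n E) k"
  shows "int k \<le> indep_complex_dim {..<n} E + 1"
proof -
  have "0 \<le> indep_complex_dim {..<n} E + 1"
    by (simp add: indep_complex_dim_def)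
  moreover have "k \<le> nat (indep_complex_dim {..<n} E + 1)"
    using assms card_independent_set_le[OF independent_set_vars_notin_prime]
    by (intro prime_chain_le[OF assms]) (fastforce simp: le_nat_iff)
  ultimately show ?thesis by linarith
qed

lemma krull_dim_quot_edge_ideal:
  "int (krull_dim_quot n (edge_ideal n E :: 'k::field mpoly set)) = indep_complex_dim {..<n} E + 1"
proof -
  obtain F where F: "independent_set {..<n} E F" "int (card F) = indep_complex_dim {..<n} E + 1"
    using ex_independent_set_card[of "{..<n}" E] by auto
  have "krull_dim_quot n (edge_ideal n E :: 'k mpoly set) = card F"
    unfolding krull_dim_quot_def
  proof (rule cSup_eq_maximum)
    show "card F \<in> {k. prime_chain n (edge_ideal n E :: 'k mpoly set) k}"
      using prime_chain_independent_set[OF F(1)] by simp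
    show "k \<le> card F" if "k \<in> {k. prime_chain n (edge_ideal n E :: 'k mpoly set) k}" for k
      using prime_chain_edge_ideal_le[of n E k, where 'a = 'k] that F(2) by simp
  qed
  then show ?thesis using F(2) by simp
qed

text \<open>The bound on chains makes the set of lengths finite, so a nonempty set attains its
  supremum. The supremum of the empty set is 0, which \<open>d > 0\<close> excludes.\<close>

lemma depth_quot_eq_dim_iff:
  fixes I :: "'k::field mpoly set"
  assumes I: "is_ideal n I" and le: "\<And>k. prime_chain n I k \<Longrightarrow> k \<le> d" and "d > 0"
  shows "depth_quot n I = d \<longleftrightarrow> (\<exists>fs. regular_seq n I fs \<and> length fs = d)"
proof -
  let ?X = "{length fs |fs. regular_seq n I fs}"
  have X: "k \<le> d" if "k \<in> ?X" for k
    using that regular_seq_prime_chain[OF I] le by auto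
  then have "?X \<subseteq> {..d}" by blast
  then have fin: "finite ?X" by (rule finite_subset) simp
  show ?thesis
  proof
    assume "depth_quot n I = d"
    then have "Sup ?X = d" by (simp add: depth_quot_def)
    moreover have "?X \<noteq> {}"
    proof
      assume "?X = {}"
      then have "Sup ?X = 0" by (simp only: Sup_nat_empty)
      with \<open>Sup ?X = d\<close> \<open>d > 0\<close> show False by linarith
    qed
    moreover from this have "Sup ?X = Max ?X" by (simp only: Sup_nat_def if_False)
    ultimately have "d \<in> ?X" using Max_in[OF fin] by simp
    then show "\<exists>fs. regular_seq n I fs \<and> length fs = d" by blast
  next
    assume "\<exists>fs. regular_seq n I fs \<and> length fs = d"
    then have "d \<in> ?X" by blast
    then show "depth_quot n I = d"
      unfolding depth_quot_def using X by (intro cSup_eq_maximum)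
  qed
qed

lemma cohen_macaulay_dim2_iff:
  fixes n :: nat and E :: "nat \<Rightarrow> nat \<Rightarrow> bool"
  defines "I \<equiv> edge_ideal n E :: 'k::field mpoly set"
  shows "cohen_macaulay n I \<and> krull_dim_quot n I = 2 \<longleftrightarrow>
    indep_complex_dim {..<n} E = 1 \<and> (\<exists>fs. regular_seq n I fs \<and> length fs = 2)"
proof (cases "indep_complex_dim {..<n} E = 1")
  case True
  then have "krull_dim_quot n I = 2"
    using krull_dim_quot_edge_ideal[of n E, where 'k = 'k] by (simp add: I_def)
  moreover have "k \<le> 2" if "prime_chain n I k" for k
    using prime_chain_edge_ideal_le[of n E k, where 'a = 'k] that True by (simp add: I_def)
  then have "depth_quot n I = 2 \<longleftrightarrow> (\<exists>fs. regular_seq n I fs \<and> length fs = 2)"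
    using is_ideal_edge_ideal[of n E] by (intro depth_quot_eq_dim_iff) (auto simp: I_def)
  ultimately show ?thesis using True by (simp add: cohen_macaulay_def)
next
  case False
  then have "krull_dim_quot n I \<noteq> 2"
    using krull_dim_quot_edge_ideal[of n E, where 'k = 'k] by (auto simp: I_def)
  then show ?thesis using False by simp
qed

subsection \<open>Depth at least two implies connectedness\<close>

text \<open>With this colon ideal, a claim about multiplying \<open>q\<close> by all elements of a
  \<open>vars_ideal\<close> reduces, through \<open>vars_ideal_subset\<close>, to a claim about
  single variables.\<close>

lemma is_ideal_colon:
  fixes q :: "'k::field mpoly"
  assumes "is_ideal n J" "q \<in> poly_ring n"
  shows "is_ideal n {p \<in> poly_ring n. p * q \<in> J}"
  unfolding is_ideal_def
  using assms is_idealD[OF assms(1)]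
  by (auto simp: distrib_right mult.assoc intro: poly_ring_intros)

lemma vars_ideal_subset:
  fixes J :: "'k::field mpoly set"
  assumes "is_ideal n J" "\<And>i. i \<in> A \<Longrightarrow> i < n \<Longrightarrow> var i \<in> J"
  shows "vars_ideal n A \<subseteq> J"
proof
  fix p :: "'k mpoly" assume p: "p \<in> vars_ideal n A"
  show "p \<in> J"
  proof (rule poly_in_idealI[OF assms(1)])
    fix m :: "nat \<Rightarrow>\<^sub>0 nat" and c :: 'k assume m: "m \<in> keys p"
    then have "keys m \<subseteq> {..<n}" using p unfolding vars_ideal_def poly_ring_def by blast
    moreover obtain i where "i \<in> keys m" "i \<in> A" using p m unfolding vars_ideal_def by blast
    ultimately show "single m c \<in> J"
      using assms(2) by (intro single_in_idealI[OF assms(1), of m i]) auto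
  qed
qed

lemma independent_set_singleton: "(\<And>i. \<not> E i i) \<Longrightarrow> i < n \<Longrightarrow> independent_set {..<n} E {i}"
  by (simp add: independent_set_def)

lemma lookup_var_mult_single: "lookup (var a * p) (single a 1) = lookup p 0"
  using lookup_mult_single_add[of "single a 1" 1 p 0] by (simp add: var_def)

text \<open>If the complex is the disjoint union of nonempty complexes on \<open>A\<close> and \<open>B\<close>, then the part
  of the first element of a regular sequence that involves \<open>A\<close> is annihilated by the maximal
  ideal modulo that element, without being a multiple of it.\<close>
lemma no_regular_seq_disconnected:
  fixes fs :: "'k::field mpoly list"
  assumes irrefl: "\<And>i. \<not> E i i"
    and AB: "A \<union> B = {..<n}" "a0 \<in> A" "b0 \<in> B" "\<And>a b. a \<in> A \<Longrightarrow> b \<in> B \<Longrightarrow> E a b"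
    and reg: "regular_seq n (edge_ideal n E) fs" "length fs = 2"
  shows False
proof -
  define I where "I = (edge_ideal n E :: 'k mpoly set)"
  have I: "is_ideal n I" unfolding I_def by (rule is_ideal_edge_ideal)
  obtain f1 f2 where fs: "fs = [f1, f2]"
    using reg(2) by (auto simp: length_Suc_conv numeral_2_eq_2)
  have max: "f1 \<in> vars_ideal n {..<n}" "f2 \<in> vars_ideal n {..<n}"
    using reg(1) by (auto simp: regular_seq_def fs max_ideal_eq)
  then have fr: "f1 \<in> poly_ring n" by (simp add: vars_ideal_def)
  define L where "L = ideal_gen n (insert f1 I)"
  have L: "is_ideal n L" "L = {a + f1 * h | a h. a \<in> I \<and> h \<in> poly_ring n}"
    unfolding L_def using is_ideal_insert[OF I fr] ideal_gen_insert[OF I fr] by simp_all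
  have "I \<subseteq> L" "f1 \<in> L" unfolding L_def using ideal_gen_superset[of "insert f1 I" n] by auto
  have reg1: "g \<in> I" if "g \<in> poly_ring n" "f1 * g \<in> I" for g
    using reg(1) that ideal_gen_ideal[OF I] by (auto simp: regular_seq_def fs I_def)
  have reg2: "g \<in> L" if "g \<in> poly_ring n" "f2 * g \<in> L" for g
    using reg(1)[unfolded regular_seq_def, THEN conjunct2, THEN conjunct2, rule_format, of 1 g] that
    by (simp add: fs I_def L_def)
  define \<alpha> where "\<alpha> = restrict_keys f1 {m. keys m \<inter> A \<noteq> {}}"
  define \<beta> where "\<beta> = restrict_keys f1 (- {m. keys m \<inter> A \<noteq> {}})"
  have f1: "f1 = \<alpha> + \<beta>" unfolding \<alpha>_def \<beta>_def by (rule restrict_keys_split)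
  have \<alpha>: "\<alpha> \<in> vars_ideal n A"
    unfolding \<alpha>_def using fr by (intro restrict_keys_in_vars_ideal) auto
  \<comment> \<open>A monomial of \<beta> avoids \<open>A\<close> and is not constant, because
    \<open>f1\<close> has no constant term; so it involves \<open>B\<close>.\<close>
  have \<beta>: "\<beta> \<in> vars_ideal n B"
    using max(1) AB(1) unfolding vars_ideal_def \<beta>_def
    by (auto simp: keys_restrict_keys intro!: poly_ring_restrict_keys) blast
  have ring: "\<alpha> \<in> poly_ring n" "\<beta> \<in> poly_ring n"
    using \<alpha> \<beta> by (simp_all add: vars_ideal_def)
  have less: "a < n" if "a \<in> A \<or> a \<in> B" for a using AB(1) that by auto
  have ab: "var a * var b \<in> I" if "a \<in> A" "b \<in> B" for a b
    unfolding I_def using that less AB(4) by (intro var_mult_in_edge_ideal) auto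
  have b\<alpha>: "var b * \<alpha> \<in> I" if "b \<in> B" for b
    using vars_ideal_subset[OF is_ideal_colon[OF I, of "var b"], of A] \<alpha> ab that less
    by (auto simp: poly_ring_var mult.commute[of "var b"])
  have a\<beta>: "var a * \<beta> \<in> I" if "a \<in> A" for a
    using vars_ideal_subset[OF is_ideal_colon[OF I, of "var a"], of B] \<beta> ab[OF that] that less
    by (auto simp: poly_ring_var mult.commute[of _ "var a"])
  \<comment> \<open>A variable from \<open>B\<close> kills \<alpha> modulo \<open>I\<close>. A
    variable from \<open>A\<close> kills \<beta>, so it sends \<alpha> to a multiple of
    \<open>f1\<close>.\<close>
  have "vars_ideal n {..<n} \<subseteq> {p \<in> poly_ring n. p * \<alpha> \<in> L}"
  proof (rule vars_ideal_subset[OF is_ideal_colon[OF L(1) ring(1)]])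
    fix i assume "i \<in> {..<n}" "i < n"
    then consider "i \<in> A" | "i \<in> B" using AB(1) by auto
    then have "var i * \<alpha> \<in> L"
    proof cases
      case 1
      have "var i * \<alpha> = var i * f1 - var i * \<beta>" by (simp add: f1 algebra_simps)
      also have "\<dots> \<in> L"
        using a\<beta>[OF 1] \<open>I \<subseteq> L\<close> \<open>f1 \<in> L\<close> \<open>i < n\<close>
        by (intro is_ideal_diff[OF L(1)] is_idealD(4)[OF L(1) _ \<open>f1 \<in> L\<close>] poly_ring_var) auto
      finally show ?thesis .
    next
      case 2
      then show ?thesis using b\<alpha> \<open>I \<subseteq> L\<close> by blast
    qed
    then show "var i \<in> {p \<in> poly_ring n. p * \<alpha> \<in> L}" using \<open>i < n\<close> by (simp add: poly_ring_var)
  qed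
  then have "\<alpha> \<in> L" using reg2[OF ring(1)] max(2) by blast
  then obtain i h where h: "\<alpha> = i + f1 * h" "i \<in> I" "h \<in> poly_ring n" using L(2) by blast
  have lookup_I: "lookup p 0 = 0" if "var c * p \<in> I" "c < n" for c p
    using lookup_edge_ideal[of "var c * p" n E "single c 1"] that
      independent_set_singleton[of E c n] irrefl
    by (simp add: I_def lookup_var_mult_single[simplified])
  \<comment> \<open>A vertex of \<open>A\<close> forces the constant term of \<open>h\<close> to be
    1, a vertex of \<open>B\<close> forces it to be 0. Both conclusions cancel \<open>f1\<close> and
    use that a single vertex is a face.\<close>
  have "f1 * (var a0 * (1 - h)) = var a0 * \<beta> + var a0 * (\<alpha> - f1 * h)"
    by (simp add: f1 algebra_simps)
  also have "\<alpha> - f1 * h = i" using h(1) by simp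
  also have "var a0 * \<beta> + var a0 * i \<in> I"
    using AB(2) less by (intro is_idealD(3)[OF I] a\<beta> is_idealD(4)[OF I _ h(2)] poly_ring_var) auto
  finally have "f1 * (var a0 * (1 - h)) \<in> I" .
  moreover have "var a0 * (1 - h) \<in> poly_ring n"
    using h(3) AB(2) less by (intro poly_ring_intros) auto
  ultimately have "lookup (1 - h) 0 = 0"
    using reg1 lookup_I[of a0 "1 - h"] AB(2) less by blast
  then have "lookup h 0 = 1" by (simp add: lookup_minus)
  have "f1 * (var b0 * h) = var b0 * \<alpha> - var b0 * i"
    by (simp add: h(1) algebra_simps)
  also have "\<dots> \<in> I"
    using AB(3) less by (intro is_ideal_diff[OF I b\<alpha>] is_idealD(4)[OF I _ h(2)] poly_ring_var) auto
  finally have "f1 * (var b0 * h) \<in> I" .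
  moreover have "var b0 * h \<in> poly_ring n"
    using h(3) AB(3) less by (intro poly_ring_intros) auto
  ultimately have "lookup h 0 = 0"
    using reg1 lookup_I[of b0 h] AB(3) less by blast
  with \<open>lookup h 0 = 1\<close> show False by simp
qed

text \<open>Two distinct vertices not joined in the graph form a face. So a component of the complex
  is completely joined in the graph to the remaining vertices.\<close>

lemma regular_seq_imp_connected:
  assumes irrefl: "\<And>i. \<not> E i i" and sym: "\<And>i j. E i j \<Longrightarrow> E j i"
    and reg: "regular_seq n (edge_ideal n E) fs" "length fs = 2"
  shows "indep_complex_connected {..<n} E"
proof (rule ccontr)
  define R where "R = (\<lambda>x y. independent_set {..<n} E {x, y} \<and> card {x, y} = 2)"
  assume "\<not> ?thesis"
  then obtain u v where uv: "u < n" "v < n" "\<not> R\<^sup>*\<^sup>* u v"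
    unfolding indep_complex_connected_def R_def by auto
  define A where "A = {w. w < n \<and> R\<^sup>*\<^sup>* u w}"
  have "E a b" if "a \<in> A" "b \<in> {..<n} - A" for a b
  proof (rule ccontr)
    assume "\<not> E a b"
    moreover have "a \<noteq> b" using that by blast
    ultimately have "R a b"
      using that irrefl sym unfolding R_def A_def independent_set_def by auto
    with that show False by (auto simp: A_def dest: rtranclp.rtrancl_into_rtrancl)
  qed
  moreover have "A \<union> ({..<n} - A) = {..<n}" "u \<in> A" "v \<in> {..<n} - A"
    using uv by (auto simp: A_def)
  ultimately show False using no_regular_seq_disconnected[of E A _ n u v] irrefl reg by blast
qed

subsection \<open>Connected complexes of dimension one have depth at least two\<close>

text \<open>Modulo the ideal belonging to \<open>e\<close> only the monomials supported in
  \<open>e\<close> count, so \<open>k\<close> is assembled monomial by monomial; compatibility makes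
  the chosen \<open>e\<close> immaterial.\<close>

lemma vars_ideal_glue:
  fixes K :: "nat set \<Rightarrow> 'k::field mpoly"
  assumes D: "finite D" and K: "\<And>e. e \<in> D \<Longrightarrow> K e \<in> poly_ring n"
    and compat: "\<And>e e' m. e \<in> D \<Longrightarrow> e' \<in> D \<Longrightarrow> keys m \<subseteq> e \<Longrightarrow> keys m \<subseteq> e' \<Longrightarrow>
      lookup (K e) m = lookup (K e') m"
  shows "\<exists>k\<in>poly_ring n. \<forall>e\<in>D. k - K e \<in> vars_ideal n ({..<n} - e)"
proof -
  define M where "M = {m \<in> (\<Union>e\<in>D. keys (K e)). \<exists>e\<in>D. keys m \<subseteq> e}"
  define ch where "ch = (\<lambda>m :: nat \<Rightarrow>\<^sub>0 nat. SOME e. e \<in> D \<and> keys m \<subseteq> e)"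
  have ch: "ch m \<in> D \<and> keys m \<subseteq> ch m" if "e \<in> D" "keys m \<subseteq> e" for m e
    unfolding ch_def by (rule someI[of _ e]) (use that in blast)
  have "M \<subseteq> (\<Union>e\<in>D. keys (K e))" unfolding M_def by blast
  then have M: "finite M" by (rule finite_subset) (simp add: D)
  define k where "k = (\<Sum>m\<in>M. single m (lookup (K (ch m)) m))"
  have lookup_k: "lookup k m = (if m \<in> M then lookup (K (ch m)) m else 0)" for m
    using M by (simp add: k_def lookup_sum lookup_single when_def)
  have k_eq: "lookup k m = lookup (K e) m" if e: "e \<in> D" "keys m \<subseteq> e" for e m
  proof (cases "m \<in> M")
    case True
    then show ?thesis using ch[OF e] compat[of e "ch m" m] e by (simp add: lookup_k)
  next
    case False
    then have "m \<notin> keys (K e)" using e unfolding M_def by blast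
    then show ?thesis using False by (simp add: lookup_k in_keys_iff)
  qed
  have k: "k \<in> poly_ring n"
    unfolding k_def
  proof (intro poly_ring_sum poly_ring_single)
    fix m assume "m \<in> M"
    then obtain e where "e \<in> D" "m \<in> keys (K e)" by (auto simp: M_def)
    then show "keys m \<subseteq> {..<n}" using K[of e] unfolding poly_ring_def by blast
  qed
  have "k - K e \<in> vars_ideal n ({..<n} - e)" if "e \<in> D" for e
  proof -
    have kK: "k - K e \<in> poly_ring n" using k K[OF that] by (rule poly_ring_diff)
    moreover have "keys m \<inter> ({..<n} - e) \<noteq> {}" if m: "m \<in> keys (k - K e)" for m
    proof
      assume "keys m \<inter> ({..<n} - e) = {}"
      moreover have "keys m \<subseteq> {..<n}" using kK m unfolding poly_ring_def by blast
      ultimately have "keys m \<subseteq> e" by blast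
      then show False using k_eq[OF \<open>e \<in> D\<close>] m by (simp add: in_keys_iff lookup_minus)
    qed
    ultimately show ?thesis by (simp add: vars_ideal_def)
  qed
  then show ?thesis using k by blast
qed

text \<open>A monomial of \<open>h\<close> supported in \<open>{u, v}\<close> must contain
  \<open>v\<close> by the first hypothesis and \<open>u\<close> by the second, hence is divisible by
  their product.\<close>

lemma vars_ideal_edge_divisible:
  fixes h :: "'k::field mpoly"
  assumes uv: "u \<noteq> v" and h: "h \<in> vars_ideal n ({..<n} - {u})" "h \<in> vars_ideal n ({..<n} - {v})"
  obtains k where "k \<in> poly_ring n" "h - var u * var v * k \<in> vars_ideal n ({..<n} - {u, v})"
proof -
  have hr: "h \<in> poly_ring n" using h by (simp add: vars_ideal_def)
  let ?N = "{m :: nat \<Rightarrow>\<^sub>0 nat. keys m \<subseteq> {u, v}}"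
  define d where "d = (single u 1 + single v 1 :: nat \<Rightarrow>\<^sub>0 nat)"
  define k where "k = (\<Sum>m\<in>keys h \<inter> ?N. single (m - d) (lookup h m))"
  have md: "d + (m - d) = m" if m: "m \<in> keys h \<inter> ?N" for m
  proof -
    have "keys m \<inter> ({..<n} - {u}) \<noteq> {}" "keys m \<inter> ({..<n} - {v}) \<noteq> {}"
      using h m unfolding vars_ideal_def by blast+
    then have "u \<in> keys m" "v \<in> keys m" using m by auto
    then show ?thesis
      using uv by (intro poly_mapping_eqI)
        (auto simp: d_def lookup_add lookup_minus lookup_single when_def in_keys_iff)
  qed
  have "keys (m - d) \<subseteq> {..<n}" if "m \<in> keys h \<inter> ?N" for m
  proof -
    have "keys m \<subseteq> {..<n}" using hr that unfolding poly_ring_def by blast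
    then show ?thesis using md[OF that] keys_add_nat by (metis Un_subset_iff)
  qed
  then have k: "k \<in> poly_ring n"
    unfolding k_def by (intro poly_ring_sum poly_ring_single)
  have "var u * var v * k = (\<Sum>m\<in>keys h \<inter> ?N. single d 1 * single (m - d) (lookup h m))"
    by (simp add: k_def sum_distrib_left var_def mult_single d_def)
  also have "\<dots> = restrict_keys h ?N"
    unfolding restrict_keys_def by (intro sum.cong) (auto simp: mult_single md)
  finally have "h - var u * var v * k = restrict_keys h (- ?N)"
    using restrict_keys_split[of h ?N] by (metis add_diff_cancel_left')
  moreover have "restrict_keys h (- ?N) \<in> vars_ideal n ({..<n} - {u, v})"
    using hr unfolding vars_ideal_def poly_ring_def by (auto simp: keys_restrict_keys)
  ultimately show ?thesis using that k by simp
qed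

lemma var_notin_vars_ideal: "i \<notin> A \<Longrightarrow> var i \<notin> vars_ideal n A"
  by (simp add: vars_ideal_def var_def)

lemma connected_imp_regular_seq:
  fixes E :: "nat \<Rightarrow> nat \<Rightarrow> bool"
  assumes irrefl: "\<And>i. \<not> E i i" and n: "n \<ge> 2"
    and conn: "indep_complex_connected {..<n} E"
    and dim: "\<And>F. independent_set {..<n} E F \<Longrightarrow> card F \<le> 2"
  shows "\<exists>fs :: 'k::field mpoly list. regular_seq n (edge_ideal n E) fs \<and> length fs = 2"
proof -
  define R where "R = (\<lambda>x y. independent_set {..<n} E {x, y} \<and> card {x, y} = 2)"
  define D where "D = {e. independent_set {..<n} E e \<and> card e = 2}"
  \<comment> \<open>Modulo \<open>P e\<close> only the polynomials in the variables of
    \<open>e\<close> survive. Passing from an edge to one of its vertices enlarges the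
    ideal.\<close>
  define P where "P = (\<lambda>e. vars_ideal n ({..<n} - e) :: 'k mpoly set)"
  define I where "I = (edge_ideal n E :: 'k mpoly set)"
  define f1 where "f1 = (\<Sum>i<n. var i :: 'k mpoly)"
  \<comment> \<open>The other terms of the second elementary symmetric polynomial lie in
    \<open>I\<close> and are left out.\<close>
  define f2 where "f2 = (\<Sum>e\<in>D. \<Prod>i\<in>e. var i :: 'k mpoly)"
  have finD: "finite D"
    unfolding D_def using finite_independent_sets[of "{..<n}" E] by (rule rev_finite_subset) auto
  have Dn: "e \<subseteq> {..<n}" if "e \<in> D" for e using that by (simp add: D_def independent_set_def)
  have I: "is_ideal n I" unfolding I_def by (rule is_ideal_edge_ideal)
  have Pi: "is_ideal n (P e)" and Pp: "prime_ideal n (P e)" for e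
    unfolding P_def by (rule is_ideal_vars_ideal prime_ideal_vars_ideal)+
  have Pmono: "P e \<subseteq> P e'" if "e' \<subseteq> e" for e e'
    unfolding P_def using that by (intro vars_ideal_mono) auto
  have IP: "I \<subseteq> P e" if "e \<in> D" for e
    using edge_ideal_subset_vars_ideal[of n E e] that by (simp add: D_def I_def P_def)
  have step: "R\<^sup>*\<^sup>* u v" if "u < n" "v < n" for u v
    using conn that by (auto simp: indep_complex_connected_def R_def)
  have vertex_in: "\<exists>e\<in>D. u \<in> e" if "u < n" for u
  proof -
    \<comment> \<open>Some vertex other than \<open>u\<close>, available since
      \<open>n \<ge> 2\<close>. The first step of a path to it is an edge at
      \<open>u\<close>.\<close>
    define w where "w = (if u = 0 then 1 else 0 :: nat)"
    have "R\<^sup>*\<^sup>* u w" "u \<noteq> w" using step[OF that, of w] n by (auto simp: w_def)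
    then obtain y where "R u y" by (metis converse_rtranclpE)
    then show ?thesis by (auto simp: R_def D_def)
  qed
  have facet: "\<exists>e\<in>D. F \<subseteq> e" if F: "independent_set {..<n} E F" for F
  proof -
    have fin: "finite F" using F by (auto simp: independent_set_def intro: finite_subset)
    consider "card F = 0" | "card F = 1" | "card F = 2" using dim[OF F] by linarith
    then show ?thesis
    proof cases
      case 1
      then show ?thesis using fin vertex_in[of 0] n by auto
    next
      case 2
      then obtain u where "F = {u}" by (auto simp: card_1_singleton_iff)
      then show ?thesis using F vertex_in[of u] by (auto simp: independent_set_def)
    next
      case 3
      then show ?thesis using F by (auto simp: D_def)
    qed
  qed
  \<comment> \<open>With \<open>IP\<close> this makes \<open>I\<close> the intersection of the
    \<open>P e\<close>, so membership can be tested edge by edge.\<close>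
  have inI: "p \<in> I" if p: "p \<in> poly_ring n" "\<And>e. e \<in> D \<Longrightarrow> p \<in> P e" for p
    unfolding I_def
  proof (rule in_edge_idealI[OF irrefl p(1)])
    fix m assume m: "m \<in> keys p"
    show "\<not> independent_set {..<n} E (keys m)"
    proof
      assume "independent_set {..<n} E (keys m)"
      then obtain e where "e \<in> D" "keys m \<subseteq> e" using facet by blast
      then show False using p(2)[of e] m by (auto simp: P_def vars_ideal_def)
    qed
  qed
  have f1r: "f1 \<in> poly_ring n" unfolding f1_def by (intro poly_ring_sum poly_ring_var) auto
  have f2r: "f2 \<in> poly_ring n"
    unfolding f2_def using Dn by (intro poly_ring_sum poly_ring_prod poly_ring_var) auto
  have f1P: "f1 \<notin> P e" if "u \<in> e" "u < n" for e u
  proof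
    assume "f1 \<in> P e"
    then have "lookup f1 (single u 1) = 0"
      unfolding P_def by (rule vars_ideal_lookup) (use that in auto)
    moreover have "lookup f1 (single u 1) = (\<Sum>i<n. if i = u then 1 else 0)"
      unfolding f1_def lookup_sum var_def
      by (intro sum.cong) (auto simp: lookup_single when_def dest: arg_cong[of _ _ keys])
    ultimately show False using that by simp
  qed
  have f1_cancel: "p \<in> P e" if "f1 * p \<in> P e" "p \<in> poly_ring n" "u \<in> e" "u < n" for p e u
    using prime_idealD(3)[OF Pp f1r that(2,1)] f1P[OF that(3,4)] by blast
  have f1_regular: "g \<in> I" if "g \<in> poly_ring n" "f1 * g \<in> I" for g
  proof (rule inI[OF that(1)])
    fix e assume e: "e \<in> D"
    then have "e \<noteq> {}" by (auto simp: D_def)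
    then obtain u where "u \<in> e" "u < n" using Dn[OF e] by blast
    then show "g \<in> P e" using f1_cancel[of g e u] that IP[OF e] by blast
  qed
  have f2_mod: "f2 - var u * var v \<in> P {u, v}" if "{u, v} \<in> D" "u \<noteq> v" for u v
  proof -
    have "f2 = (\<Prod>i\<in>{u, v}. var i) + (\<Sum>e\<in>D - {{u, v}}. \<Prod>i\<in>e. var i)"
      unfolding f2_def using finD that(1) by (rule sum.remove)
    then have "f2 - var u * var v = (\<Sum>e\<in>D - {{u, v}}. \<Prod>i\<in>e. var i)"
      using that(2) by simp
    also have "\<dots> \<in> P {u, v}"
    proof (rule is_ideal_sum[OF Pi])
      fix e assume e: "e \<in> D - {{u, v}}"
      then have "\<not> e \<subseteq> {u, v}"
        using that card_subset_eq[of "{u, v}" e] by (auto simp: D_def)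
      then obtain w where w: "w \<in> e" "w \<notin> {u, v}" by blast
      then have "w < n" using Dn e by blast
      have "finite e" using e Dn by (auto intro: finite_subset)
      then have "(\<Prod>i\<in>e. var i :: 'k mpoly) = var w * (\<Prod>i\<in>e - {w}. var i)"
        using w(1) by (rule prod.remove)
      also have "\<dots> \<in> P {u, v}"
        using w \<open>w < n\<close> Dn e unfolding P_def
        by (intro is_idealD(5)[OF is_ideal_vars_ideal] var_in_vars_ideal poly_ring_prod poly_ring_var)
          auto
      finally show "(\<Prod>i\<in>e. var i :: 'k mpoly) \<in> P {u, v}" .
    qed
    finally show ?thesis .
  qed
  have f2_regular: "g \<in> ideal_gen n (insert f1 I)"
    if g: "g \<in> poly_ring n" and f2g: "f2 * g \<in> ideal_gen n (insert f1 I)" for g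
  proof -
    from f2g obtain i h where h: "f2 * g = i + f1 * h" "i \<in> I" "h \<in> poly_ring n"
      unfolding ideal_gen_insert[OF I f1r] by blast
    \<comment> \<open>On the edge, \<open>var u * var v * g\<close> agrees with
      \<open>f1 * h\<close>. At each endpoint the left side vanishes and \<open>f1\<close> does not,
      so \<open>h\<close> vanishes there and is divisible by \<open>var u * var v\<close>, which can
      then be cancelled.\<close>
    have local: "\<exists>k\<in>poly_ring n. g - f1 * k \<in> P e" if e: "e \<in> D" for e
    proof -
      obtain u v where uv: "e = {u, v}" "u \<noteq> v" using e by (auto simp: D_def card_2_iff)
      have less: "u < n" "v < n" using Dn[OF e] uv by auto
      have uvr: "var u \<in> poly_ring n" "var v \<in> poly_ring n"
        using less by (simp_all add: poly_ring_var)
      have "(f2 - var u * var v) * g \<in> P e"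
        using f2_mod[of u v] uv e g by (intro is_idealD(5)[OF Pi]) auto
      then have "i - (f2 - var u * var v) * g \<in> P e"
        using IP[OF e] h(2) by (intro is_ideal_diff[OF Pi]) auto
      also have "i - (f2 - var u * var v) * g = var u * var v * g - f1 * h"
        using h(1) by (simp add: algebra_simps)
      finally have diff: "var u * var v * g - f1 * h \<in> P e" .
      have "h \<in> P {w}" if "w \<in> e" for w
      proof -
        have "var u \<in> P {w} \<or> var v \<in> P {w}"
          using uv less unfolding P_def by (auto intro: var_in_vars_ideal)
        then have "var u * var v \<in> P {w}" using uvr by (auto intro: is_idealD(4,5)[OF Pi])
        then have "var u * var v * g \<in> P {w}" by (rule is_idealD(5)[OF Pi g])
        moreover have "var u * var v * g - f1 * h \<in> P {w}"
          using diff Pmono[of "{w}" e] that by auto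
        ultimately have "f1 * h \<in> P {w}" using is_ideal_diff[OF Pi] by fastforce
        then show ?thesis using f1_cancel[of h "{w}" w] h(3) Dn[OF e] that by auto
      qed
      then obtain k where k: "k \<in> poly_ring n" "h - var u * var v * k \<in> P e"
        using vars_ideal_edge_divisible[OF uv(2), of h n] uv(1) unfolding P_def by blast
      have "(var u * var v) * (g - f1 * k) = (var u * var v * g - f1 * h) + f1 * (h - var u * var v * k)"
        by (simp add: algebra_simps)
      also have "\<dots> \<in> P e"
        by (intro is_idealD(3)[OF Pi] diff is_idealD(4)[OF Pi] f1r k)
      finally have "(var u * var v) * (g - f1 * k) \<in> P e" .
      moreover have "var u * var v \<notin> P e"
        using prime_idealD(3)[OF Pp uvr, of e] uv by (auto simp: P_def var_notin_vars_ideal)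
      moreover have "g - f1 * k \<in> poly_ring n" by (intro poly_ring_diff poly_ring_mult g f1r k)
      ultimately have "g - f1 * k \<in> P e"
        using prime_idealD(3)[OF Pp, of "var u * var v" "g - f1 * k" e] uvr poly_ring_mult by blast
      then show ?thesis using k(1) by blast
    qed
    then obtain K where K: "\<And>e. e \<in> D \<Longrightarrow> K e \<in> poly_ring n"
      "\<And>e. e \<in> D \<Longrightarrow> g - f1 * K e \<in> P e" by metis
    \<comment> \<open>At a common vertex both quotients solve the same equation, and
      \<open>f1\<close> can be cancelled modulo the prime \<open>P {u}\<close>.\<close>
    have share: "lookup (K e) m = lookup (K e') m"
      if e: "e \<in> D" "e' \<in> D" "u \<in> e" "u \<in> e'" and m: "keys m \<subseteq> {u}" for e e' u m
    proof -
      have Ku: "g - f1 * K x \<in> P {u}" if "x \<in> D" "u \<in> x" for x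
        using K(2)[OF that(1)] Pmono[of "{u}" x] that(2) by auto
      have "(g - f1 * K e') - (g - f1 * K e) \<in> P {u}"
        by (rule is_ideal_diff[OF Pi Ku[OF e(2,4)] Ku[OF e(1,3)]])
      also have "(g - f1 * K e') - (g - f1 * K e) = f1 * (K e - K e')"
        by (simp add: algebra_simps)
      finally have "f1 * (K e - K e') \<in> P {u}" .
      moreover have "u < n" using Dn[OF e(1)] e(3) by auto
      ultimately have "K e - K e' \<in> P {u}"
        using f1_cancel[of "K e - K e'" "{u}" u] poly_ring_diff[OF K(1)[OF e(1)] K(1)[OF e(2)]] by simp
      then have "lookup (K e - K e') m = 0"
        unfolding P_def by (rule vars_ideal_lookup) (use m in auto)
      then show ?thesis by (simp add: lookup_minus)
    qed
    \<comment> \<open>Disjoint edges share no vertex at which to compare them; the constant term is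
      carried along a path between them. This is where the regularity of \<open>f2\<close> rests on
      connectedness.\<close>
    have const: "lookup (K e) 0 = lookup (K e') 0" if e: "e \<in> D" "e' \<in> D" for e e'
    proof -
      have "\<forall>e'\<in>D. v \<in> e' \<longrightarrow> lookup (K e) 0 = lookup (K e') 0" if "R\<^sup>*\<^sup>* u v" "u \<in> e" for u v
        using that
      proof (induction rule: rtranclp_induct)
        case base
        then show ?case using share[OF e(1)] by auto
      next
        case (step y z)
        then have yz: "{y, z} \<in> D" by (simp add: R_def D_def)
        then have "lookup (K e) 0 = lookup (K {y, z}) 0" using step by auto
        then show ?case using share[OF yz, of _ z 0] by auto
      qed
      moreover obtain u v where "u \<in> e" "v \<in> e'" using e by (fastforce simp: D_def card_2_iff)
      ultimately show ?thesis using e step[of u v] Dn by blast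
    qed
    \<comment> \<open>A monomial in two variables determines its edge, a power of one variable is
      settled at that vertex, and the constant monomial by \<open>const\<close>.\<close>
    have compat: "lookup (K e) m = lookup (K e') m"
      if e: "e \<in> D" "e' \<in> D" "keys m \<subseteq> e" "keys m \<subseteq> e'" for e e' m
    proof (cases "m = 0")
      case True
      then show ?thesis using const[OF e(1,2)] by simp
    next
      case False
      then obtain u where u: "u \<in> keys m" by (metis ex_in_conv keys_eq_empty)
      show ?thesis
      proof (cases "keys m \<subseteq> {u}")
        case True
        then show ?thesis using share[of e e' u m] e u by blast
      next
        case False
        then obtain w where "w \<in> keys m" "w \<noteq> u" by blast
        then have "{u, w} \<subseteq> e" "{u, w} \<subseteq> e'" "card {u, w} = 2" using u e by auto
        moreover have "{u, w} = x" if "x \<in> D" "{u, w} \<subseteq> x" "card {u, w} = 2" for x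
          using that card_subset_eq[of x "{u, w}"] Dn[OF that(1)] by (auto simp: D_def finite_subset)
        ultimately show ?thesis using e(1,2) by metis
      qed
    qed
    have "\<exists>k\<in>poly_ring n. \<forall>e\<in>D. k - K e \<in> P e"
      unfolding P_def by (rule vars_ideal_glue[OF finD K(1) compat])
    then obtain k where k: "k \<in> poly_ring n" "\<And>e. e \<in> D \<Longrightarrow> k - K e \<in> P e" by auto
    have "g - f1 * k \<in> I"
    proof (rule inI)
      show "g - f1 * k \<in> poly_ring n" by (intro poly_ring_diff poly_ring_mult g f1r k)
      fix e assume e: "e \<in> D"
      have "g - f1 * k = (g - f1 * K e) - f1 * (k - K e)" by (simp add: algebra_simps)
      also have "\<dots> \<in> P e"
        by (rule is_ideal_diff[OF Pi K(2)[OF e] is_idealD(4)[OF Pi f1r k(2)[OF e]]])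
      finally show "g - f1 * k \<in> P e" .
    qed
    moreover have "g = (g - f1 * k) + f1 * k" by simp
    ultimately show ?thesis unfolding ideal_gen_insert[OF I f1r] using k(1) by blast
  qed
  \<comment> \<open>\<open>P {}\<close> is the ideal of all variables, so it also witnesses that the
    generated ideal is proper.\<close>
  have in_max: "f1 \<in> P {}" "f2 \<in> P {}" "I \<subseteq> P {}"
  proof -
    show "f1 \<in> P {}"
      unfolding f1_def P_def by (intro is_ideal_sum[OF is_ideal_vars_ideal] var_in_vars_ideal) auto
    have "(\<Prod>i\<in>e. var i :: 'k mpoly) \<in> P {}" if e: "e \<in> D" for e
    proof -
      obtain u v where "e = {u, v}" "u \<noteq> v" using e by (auto simp: D_def card_2_iff)
      then show ?thesis
        using Dn[OF e] unfolding P_def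
        by (auto intro!: is_idealD(4)[OF is_ideal_vars_ideal] var_in_vars_ideal poly_ring_var)
    qed
    then show "f2 \<in> P {}" unfolding f2_def by (intro is_ideal_sum[OF Pi])
    show "I \<subseteq> P {}"
      using edge_ideal_subset_vars_ideal[of n E "{}"] by (simp add: I_def P_def independent_set_def)
  qed
  have "regular_seq n I [f1, f2]"
    unfolding regular_seq_def
  proof (intro conjI allI impI ballI)
    show "set [f1, f2] \<subseteq> max_ideal n"
      using in_max by (simp add: P_def max_ideal_eq)
    have "ideal_gen n (I \<union> set [f1, f2]) \<subseteq> P {}"
      using in_max by (intro ideal_gen_subset Pi) auto
    then show "ideal_gen n (I \<union> set [f1, f2]) \<noteq> poly_ring n"
      using prime_idealD(2)[OF Pp[of "{}"]] poly_ring_one[of n] by blast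
    fix k g assume *: "k < length [f1, f2]" "g \<in> poly_ring n"
      "[f1, f2] ! k * g \<in> ideal_gen n (I \<union> set (take k [f1, f2]))"
    then consider "k = 0" | "k = 1" by fastforce
    then show "g \<in> ideal_gen n (I \<union> set (take k [f1, f2]))"
    proof cases
      case 1
      then show ?thesis using * f1_regular[of g] ideal_gen_ideal[OF I] by simp
    next
      case 2
      then show ?thesis using * f2_regular[of g] by simp
    qed
  qed
  then show ?thesis unfolding I_def by (intro exI[of _ "[f1, f2]"]) simp
qed

subsection \<open>Circulant graphs\<close>

lemma circulant_adj_irrefl: "\<not> circulant_adj n S i i"
  by (simp add: circulant_adj_def)

lemma circ_dist_commute: "circ_dist n i j = circ_dist n j i"
  by (auto simp: circ_dist_def)

lemma circulant_adj_sym: "circulant_adj n S i j \<Longrightarrow> circulant_adj n S j i"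
  by (auto simp: circulant_adj_def circ_dist_commute)

lemma circ_dist_in_range: "i < n \<Longrightarrow> j < n \<Longrightarrow> i \<noteq> j \<Longrightarrow> circ_dist n i j \<in> {1..n div 2}"
  by (auto simp: circ_dist_def min_def)

lemma circ_dist_eqI:
  assumes "x < n" "y < n" "2 * s \<le> n" "int y = int x + int s \<or> int y = int x + int s - int n"
  shows "circ_dist n x y = s"
  using assms by (auto simp: circ_dist_def min_def)

lemma circ_dist_dvd:
  assumes "d dvd n" "d dvd circ_dist n x y" "x < n" "y < n"
  shows "int d dvd int x - int y"
proof -
  let ?c = "int (circ_dist n x y)"
  have "int d dvd int n" "int d dvd ?c" using assms by simp_all
  then have "int d dvd ?c" "int d dvd - ?c" "int d dvd int n - ?c" "int d dvd ?c - int n"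
    by simp_all
  moreover have "int x - int y \<in> {?c, - ?c, int n - ?c, ?c - int n}"
    using assms(3,4) by (auto simp: circ_dist_def min_def)
  ultimately show ?thesis by auto
qed

text \<open>The edges of the independence complex; they form the circulant graph on the complement
  of \<open>S\<close>.\<close>

definition nonadj :: "nat \<Rightarrow> nat set \<Rightarrow> nat \<Rightarrow> nat \<Rightarrow> bool" where
  "nonadj n S x y \<longleftrightarrow> x < n \<and> y < n \<and> x \<noteq> y \<and> circ_dist n x y \<in> {1..n div 2} - S"

lemma independent_set_circulant:
  "independent_set {..<n} (circulant_adj n S) F \<longleftrightarrow>
    F \<subseteq> {..<n} \<and> (\<forall>x\<in>F. \<forall>y\<in>F. x \<noteq> y \<longrightarrow> circ_dist n x y \<in> {1..n div 2} - S)"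
  unfolding independent_set_def circulant_adj_def using circ_dist_in_range by blast

lemma nonadj_iff: "independent_set {..<n} (circulant_adj n S) {x, y} \<and> card {x, y} = 2 \<longleftrightarrow> nonadj n S x y"
  by (auto simp: independent_set_circulant nonadj_def circ_dist_commute[of n y x] card_insert_if)

lemma nonadj_sym: "nonadj n S x y \<Longrightarrow> nonadj n S y x"
  by (auto simp: nonadj_def circ_dist_commute)

section \<open>Connectedness and the greatest common divisor\<close>

lemma connected_circulant_iff:
  "indep_complex_connected {..<n} (circulant_adj n S) \<longleftrightarrow> (\<forall>u<n. \<forall>v<n. (nonadj n S)\<^sup>*\<^sup>* u v)"
  by (simp add: indep_complex_connected_def nonadj_iff Ball_def)

text \<open>Each step of a walk changes the position by a multiple of the gcd, also when it wraps
  around, because the gcd divides \<open>n\<close>.\<close>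

lemma Gcd_dvd_of_connected:
  assumes "(nonadj n S)\<^sup>*\<^sup>* u v"
  shows "int (Gcd (insert n ({1..n div 2} - S))) dvd int u - int v"
  using assms
proof (induction rule: rtranclp_induct)
  case (step y z)
  have "int (Gcd (insert n ({1..n div 2} - S))) dvd int y - int z"
    using step.hyps(2)
    by (intro circ_dist_dvd[of _ n]) (auto simp: nonadj_def intro!: Gcd_dvd simp del: Gcd_insert)
  with step.IH have "int (Gcd (insert n ({1..n div 2} - S))) dvd (int u - int y) + (int y - int z)"
    by (rule dvd_add)
  then show ?case by simp
qed simp

text \<open>Bezout's identity, applied to one element of \<open>A\<close> at a time.\<close>

lemma Gcd_in_subgroup:
  assumes H: "0 \<in> H" "\<And>x y. x \<in> H \<Longrightarrow> y \<in> H \<Longrightarrow> x + y \<in> H" "\<And>x. x \<in> H \<Longrightarrow> - x \<in> H"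
    and A: "finite A" "int ` A \<subseteq> H"
  shows "int (Gcd A) \<in> H"
proof -
  have nat_mult: "int k * x \<in> H" if "x \<in> H" for k x
    using that by (induction k) (auto simp: distrib_right H)
  have mult: "z * x \<in> H" if "x \<in> H" for z x
    using nat_mult[OF that, of "nat \<bar>z\<bar>"] H(3) by (cases "z \<ge> 0") force+
  show ?thesis
    using A
  proof (induction A rule: finite_induct)
    case (insert a A)
    obtain u v where "u * int a + v * int (Gcd A) = gcd (int a) (int (Gcd A))"
      using bezout_int by blast
    moreover have "u * int a + v * int (Gcd A) \<in> H"
      using insert by (intro H mult) auto
    ultimately show ?case by (simp add: gcd_int_int_eq)
  qed (simp add: H)
qed

lemma connected_of_Gcd:
  assumes "Gcd (insert n ({1..n div 2} - S)) = 1" "n > 0" "u < n" "v < n"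
  shows "(nonadj n S)\<^sup>*\<^sup>* u v"
proof -
  \<comment> \<open>Vertices are lifted to integers so that shifts can be added and negated freely.
    \<open>H\<close> collects the shifts that never leave a component; it is a subgroup containing
    \<open>n\<close> and all allowed distances, hence their gcd.\<close>
  define P where "P = (\<lambda>a b :: int. (nonadj n S)\<^sup>*\<^sup>* (nat (a mod int n)) (nat (b mod int n)))"
  define H where "H = {k. \<forall>a. P a (a + k)}"
  have "symp (nonadj n S)" by (rule sympI) (rule nonadj_sym)
  then have sym: "P b a" if "P a b" for a b
    using that unfolding P_def by (rule sympD[OF symp_rtranclp])
  have trans: "P a c" if "P a b" "P b c" for a b c
    using that unfolding P_def by (rule rtranclp_trans)
  have "0 \<in> H" by (simp add: H_def P_def)
  moreover have add: "x + y \<in> H" if "x \<in> H" "y \<in> H" for x y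
    unfolding H_def
  proof safe
    fix a
    have "P a (a + x)" "P (a + x) (a + x + y)" using that by (simp_all add: H_def)
    from trans[OF this] show "P a (a + (x + y))" by (simp add: add.assoc)
  qed
  moreover have "- x \<in> H" if "x \<in> H" for x
    unfolding H_def
  proof safe
    fix a
    have "P (a - x) (a - x + x)" using that unfolding H_def by blast
    from sym[OF this] show "P a (a + - x)" by simp
  qed
  moreover have "int s \<in> H" if s: "s \<in> {1..n div 2} - S" for s
    unfolding H_def
  proof safe
    fix a :: int
    define x where "x = nat (a mod int n)"
    define y where "y = nat ((a + int s) mod int n)"
    have x: "int x = a mod int n" "x < n" using \<open>n > 0\<close> by (auto simp: x_def nat_less_iff)
    have y: "int y = (a + int s) mod int n" "y < n" using \<open>n > 0\<close> by (auto simp: y_def nat_less_iff)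
    have s': "1 \<le> s" "2 * s \<le> n" using s by auto
    have "int y = (int x + int s) mod int n" by (simp add: x y mod_add_left_eq)
    also have "\<dots> = (if x + s < n then int x + int s else int x + int s - int n)"
    proof (cases "x + s < n")
      case False
      then have "(int x + int s) mod int n = (int x + int s - int n) mod int n" by simp
      also have "\<dots> = int x + int s - int n"
        using False x s' by (intro mod_pos_pos_trivial) auto
      finally show ?thesis using False by simp
    qed simp
    finally have y_eq: "int y = int x + int s \<or> int y = int x + int s - int n" by presburger
    then have "x \<noteq> y" using s' by auto
    moreover have "circ_dist n x y = s" using x(2) y(2) s'(2) y_eq by (rule circ_dist_eqI)
    ultimately have "nonadj n S x y" using x(2) y(2) s by (simp add: nonadj_def)
    then show "P a (a + int s)" by (simp add: P_def x_def y_def)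
  qed
  moreover have "int n \<in> H" by (simp add: H_def P_def)
  ultimately have "int (Gcd (insert n ({1..n div 2} - S))) \<in> H"
    by (intro Gcd_in_subgroup) (auto simp del: Gcd_insert)
  then have "1 \<in> H" using assms by simp
  have up: "P (int a) (int a + int k)" for a k
  proof (induction k)
    case (Suc k)
    have "P (int a + int k) (int a + int k + 1)" using \<open>1 \<in> H\<close> by (simp add: H_def)
    from trans[OF Suc this] show ?case by (simp add: algebra_simps)
  qed (simp add: P_def)
  have "P (int u) (int v)"
  proof (cases "u \<le> v")
    case True
    then show ?thesis using up[of u "v - u"] by simp
  next
    case False
    then show ?thesis using sym[OF up[of v "u - v"]] by simp
  qed
  then show ?thesis using assms by (simp add: P_def)
qed

lemma connected_circulant_iff_Gcd:
  assumes "n \<ge> 2"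
  shows "indep_complex_connected {..<n} (circulant_adj n S)
    \<longleftrightarrow> Gcd (insert n ({1..n div 2} - S)) = 1"
proof
  assume "indep_complex_connected {..<n} (circulant_adj n S)"
  then have "(nonadj n S)\<^sup>*\<^sup>* 1 0" using assms by (simp add: connected_circulant_iff)
  from Gcd_dvd_of_connected[OF this]
  show "Gcd (insert n ({1..n div 2} - S)) = 1" by simp
next
  assume "Gcd (insert n ({1..n div 2} - S)) = 1"
  then show "indep_complex_connected {..<n} (circulant_adj n S)"
    using assms connected_of_Gcd unfolding connected_circulant_iff by simp
qed

section \<open>Triangles in the independence complex\<close>

lemma ex_three_ordered:
  fixes F :: "'a::linorder set"
  assumes "card F > 2"
  obtains x y z where "x \<in> F" "y \<in> F" "z \<in> F" "x < y" "y < z"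
proof -
  obtain T where "T \<subseteq> F" "card T = 3"
    using obtain_subset_with_card_n[of 3 F] assms by auto
  then obtain a b c where abc: "a \<in> F" "b \<in> F" "c \<in> F" "a \<noteq> b" "b \<noteq> c" "a \<noteq> c"
    by (auto simp: card_3_iff)
  then consider "a < b" "b < c" | "a < c" "c < b" | "b < a" "a < c" | "b < c" "c < a"
    | "c < a" "a < b" | "c < b" "b < a"
    by (metis linorder_neqE)
  then show ?thesis using that abc by cases blast+
qed

text \<open>Up to order, the three circular distances \<open>a\<close>, \<open>b\<close>, \<open>c\<close> between three vertices satisfy
  \<open>c = a + b\<close> or \<open>a + b + c = n\<close>.\<close>
lemma no_triangle_iff:
  assumes "Sbar = {1..n div 2} - S"
  shows "(\<forall>F. independent_set {..<n} (circulant_adj n S) F \<longrightarrow> card F \<le> 2) \<longleftrightarrow>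
    (\<forall>a\<in>Sbar. \<forall>b\<in>Sbar. int b - int a \<notin> int ` Sbar \<and> int n - (int b + int a) \<notin> int ` Sbar)"
    (is "?L \<longleftrightarrow> ?R")
proof
  assume L: ?L
  \<comment> \<open>A violation of the arithmetic condition yields a triangle at the vertex 0:
    \<open>0, a, b\<close> if \<open>b - a\<close> is an allowed distance, and
    \<open>0, a, a + b\<close> if \<open>n - (b + a)\<close> is one.\<close>
  have no: False
    if abc: "a \<in> Sbar" "b \<in> Sbar" "c \<in> Sbar" "0 < a" "a < z" "z < n"
      "circ_dist n 0 a = a" "circ_dist n a z = c" "circ_dist n 0 z = b" for a b c z
  proof -
    have "independent_set {..<n} (circulant_adj n S) {0, a, z}"
      using that circ_dist_commute[of n a 0] circ_dist_commute[of n z 0] circ_dist_commute[of n z a]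
      unfolding independent_set_circulant assms by auto
    moreover have "card {0, a, z} = 3" using abc by simp
    ultimately show False using L by (metis Suc_n_not_le_n eval_nat_numeral(3))
  qed
  show ?R
  proof (intro ballI conjI notI)
    fix a b assume ab: "a \<in> Sbar" "b \<in> Sbar"
    have range: "1 \<le> x \<and> 2 * x \<le> n" if "x \<in> Sbar" for x using that assms by auto
    note r = range[OF ab(1)] range[OF ab(2)]
    {
      assume "int b - int a \<in> int ` Sbar"
      then obtain c where c: "c \<in> Sbar" "int b - int a = int c" by auto
      then show False
        using r range[OF c(1)] ab by (intro no[of a b c b]) (auto intro!: circ_dist_eqI)
    next
      assume "int n - (int b + int a) \<in> int ` Sbar"
      then obtain c where c: "c \<in> Sbar" "int n - (int b + int a) = int c" by auto
      then show False
        using r range[OF c(1)] ab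
        by (intro no[of a c b "a + b"])
          (auto intro!: circ_dist_eqI simp: circ_dist_commute[of n 0 "a + b"])
    }
  qed
next
  assume R: ?R
  show ?L
  proof (intro allI impI)
    fix F assume F: "independent_set {..<n} (circulant_adj n S) F"
    show "card F \<le> 2"
    proof (rule ccontr)
      assume "\<not> card F \<le> 2"
      then have "card F > 2" by simp
      then obtain x y z where xyz: "x \<in> F" "y \<in> F" "z \<in> F" "x < y" "y < z"
        by (rule ex_three_ordered)
      define a where "a = circ_dist n x y"
      define b where "b = circ_dist n y z"
      define c where "c = circ_dist n x z"
      have abc: "a \<in> Sbar" "b \<in> Sbar" "c \<in> Sbar"
        using F xyz unfolding independent_set_circulant a_def b_def c_def assms by auto
      have "z < n" using F xyz by (auto simp: independent_set_def)
      \<comment> \<open>The three arcs cut out of the cycle by \<open>x\<close>, \<open>y\<close>,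
        \<open>z\<close> add up to \<open>n\<close>. If one is longer than half of \<open>n\<close>,
        its circular distance is the sum of the other two; otherwise the distances are the arcs
        themselves.\<close>
      then have "int c - int a = int b \<or> int a - int b = int c \<or> int b - int a = int c
          \<or> int n - (int b + int a) = int c"
        using xyz(4,5) by (auto simp: a_def b_def c_def circ_dist_def min_def)
      then show False using R abc by (metis image_eqI)
    qed
  qed
qed

text \<open>A distance \<open>s\<close> outside \<open>S\<close> makes \<open>{0, s}\<close> a face,
  so the dimension is always at least one and only the upper bound is in question.\<close>

lemma dim_circulant_eq_1_iff:
  assumes "S \<subset> {1..n div 2}"
  shows "indep_complex_dim {..<n} (circulant_adj n S) = 1 \<longleftrightarrow>
    (\<forall>F. independent_set {..<n} (circulant_adj n S) F \<longrightarrow> card F \<le> 2)"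
proof -
  obtain s where s: "s \<in> {1..n div 2} - S" using assms by blast
  have "nonadj n S 0 s"
    using s circ_dist_eqI[of 0 n s s] by (auto simp: nonadj_def)
  then have "independent_set {..<n} (circulant_adj n S) {0, s} \<and> card {0, s} = 2"
    by (simp only: nonadj_iff)
  then have "1 \<le> indep_complex_dim {..<n} (circulant_adj n S)"
    using card_independent_set_le[of n _ "{0, s}"] by fastforce
  moreover obtain F where "independent_set {..<n} (circulant_adj n S) F"
    "int (card F) = indep_complex_dim {..<n} (circulant_adj n S) + 1"
    using ex_independent_set_card[of "{..<n}" "circulant_adj n S"] by auto
  ultimately show ?thesis
    using card_independent_set_le[of n "circulant_adj n S"] by fastforce
qed

theorem theorem4p1:
  fixes n :: nat and S :: "nat set"
  assumes "n \<ge> 2"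
    and "S \<subset> {1..n div 2}"
  defines "Sbar \<equiv> {1..n div 2} - S"
  shows "((cohen_macaulay n (edge_ideal n (circulant_adj n S) :: 'k::field mpoly set)
            \<and> krull_dim_quot n (edge_ideal n (circulant_adj n S) :: 'k mpoly set) = 2)
     \<longleftrightarrow> (indep_complex_connected {..<n} (circulant_adj n S)
            \<and> indep_complex_dim {..<n} (circulant_adj n S) = 1))
     \<and> ((indep_complex_connected {..<n} (circulant_adj n S)
            \<and> indep_complex_dim {..<n} (circulant_adj n S) = 1)
     \<longleftrightarrow> (Gcd (insert n Sbar) = 1
            \<and> (\<forall>a\<in>Sbar. \<forall>b\<in>Sbar. (int b - int a) \<notin> int ` Sbar
                 \<and> (int n - (int b + int a)) \<notin> int ` Sbar)))"
proof (intro conjI)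
  let ?E = "circulant_adj n S"
  note dim = dim_circulant_eq_1_iff[OF assms(2)]
  have "(\<exists>fs :: 'k mpoly list. regular_seq n (edge_ideal n ?E) fs \<and> length fs = 2)
      \<longleftrightarrow> indep_complex_connected {..<n} ?E"
    if "indep_complex_dim {..<n} ?E = 1"
  proof
    assume "\<exists>fs :: 'k mpoly list. regular_seq n (edge_ideal n ?E) fs \<and> length fs = 2"
    then show "indep_complex_connected {..<n} ?E"
      using regular_seq_imp_connected[of ?E n, OF circulant_adj_irrefl circulant_adj_sym] by blast
  next
    assume "indep_complex_connected {..<n} ?E"
    then show "\<exists>fs :: 'k mpoly list. regular_seq n (edge_ideal n ?E) fs \<and> length fs = 2"
      using that unfolding dim
      by (intro connected_imp_regular_seq[of ?E n, OF circulant_adj_irrefl assms(1)]) blast+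
  qed
  then show "(cohen_macaulay n (edge_ideal n ?E :: 'k mpoly set)
      \<and> krull_dim_quot n (edge_ideal n ?E :: 'k mpoly set) = 2)
    \<longleftrightarrow> (indep_complex_connected {..<n} ?E \<and> indep_complex_dim {..<n} ?E = 1)"
    unfolding cohen_macaulay_dim2_iff by blast
  show "(indep_complex_connected {..<n} ?E \<and> indep_complex_dim {..<n} ?E = 1)
    \<longleftrightarrow> (Gcd (insert n Sbar) = 1 \<and> (\<forall>a\<in>Sbar. \<forall>b\<in>Sbar.
      int b - int a \<notin> int ` Sbar \<and> int n - (int b + int a) \<notin> int ` Sbar))"
    unfolding dim no_triangle_iff[OF Sbar_def[THEN meta_eq_to_obj_eq]]
      connected_circulant_iff_Gcd[OF assms(1)] Sbar_def ..
qed

end
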